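(* Let $\mathbf r=(r_i)_{i\ge1}$ be an arbitrary positive rate function on the edges of the nearest-neighbor graph on $\mathbb Z^+=\{0,1,2,\dots\}$ such that the associated random walk $(Z_t)_{t\ge0}$ started at $0$ does not explode, and let $t>0$. Then $\mathbf E[|Z_t|]$ is monotone increasing in $\mathbf r$; that is, if $\mathbf r,\mathbf r'$ are two such rate functions with $r_i\le r'_i$ for all $i$, then $\mathbf E[|Z_t|]$ for rates $\mathbf r$ is at most $\mathbf E[|Z_t|]$ for rates $\mathbf r'$ (values in $[0,\infty]$).
   Context: The rate $r_i>0$ is attached to the edge between $i-1$ and $i$, for $i\ge1$. The random walk $(Z_t)_{t\ge0}$ is the continuous-time Markov chain on $\mathbb Z^+$ with $Z_0=0$ that jumps from $i-1$ to $i$ and from $i$ to $i-1$ at rate $r_i$ for each $i\ge1$. No explosion means that a.s. only finitely many jumps occur in each bounded time interval. $|Z_t|=Z_t$ is the distance from $0$. *)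

theory Defs
  imports "HOL-Probability.Probability"
begin

text \<open>
  A rate function is some \<open>r :: nat \<Rightarrow> real\<close>, where \<open>r i\<close> for \<open>i \<ge> 1\<close> is the rate of the edge between
  \<open>i - 1\<close> and \<open>i\<close>. The value \<open>r 0\<close> is never used.
\<close>

definition jump_rate :: "(nat \<Rightarrow> real) \<Rightarrow> nat \<Rightarrow> nat \<Rightarrow> real" where
  "jump_rate r i j = (if j = Suc i then r j else if i = Suc j then r i else 0)"

definition exit_rate :: "(nat \<Rightarrow> real) \<Rightarrow> nat \<Rightarrow> real" where
  "exit_rate r i = (\<Sum>j\<le>Suc i. jump_rate r i j)"

text \<open>
  \<open>Y\<close> is the jump chain and \<open>S\<close> is the sequence of holding times of the continuous-time chain started
  at \<open>0\<close>: \<open>Y\<close> is a discrete-time Markov chain from \<open>0\<close> with transition probabilities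
  \<open>jump_rate r i j / exit_rate r i\<close>, and conditionally on \<open>Y 0, \<dots>, Y n\<close> the holding times
  \<open>S 0, \<dots>, S n\<close> are independent, \<open>S k\<close> being exponential with parameter \<open>exit_rate r (Y k)\<close>.
  The conditional statement is written multiplied out, in terms of tail probabilities.
\<close>

definition jump_hold_chain ::
  "'w measure \<Rightarrow> (nat \<Rightarrow> real) \<Rightarrow> (nat \<Rightarrow> 'w \<Rightarrow> nat) \<Rightarrow> (nat \<Rightarrow> 'w \<Rightarrow> real) \<Rightarrow> bool" where
  "jump_hold_chain M r Y S \<longleftrightarrow>
     (\<forall>n. Y n \<in> M \<rightarrow>\<^sub>M count_space UNIV) \<and>
     (\<forall>n. S n \<in> borel_measurable M) \<and>
     (\<forall>n y. measure M {\<omega> \<in> space M. \<forall>k\<le>n. Y k \<omega> = y k} =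
        (if y 0 = 0 then 1 else 0) *
        (\<Prod>k<n. jump_rate r (y k) (y (Suc k)) / exit_rate r (y k))) \<and>
     (\<forall>n y s. (\<forall>k\<le>n. 0 \<le> s k) \<longrightarrow>
        measure M {\<omega> \<in> space M. \<forall>k\<le>n. Y k \<omega> = y k \<and> s k < S k \<omega>} =
        measure M {\<omega> \<in> space M. \<forall>k\<le>n. Y k \<omega> = y k} *
        (\<Prod>k\<le>n. exp (- exit_rate r (y k) * s k)))"

text \<open>
  The process sits at \<open>Y n\<close> from the time of the \<open>n\<close>-th jump, \<open>S 0 + \<dots> + S (n - 1)\<close>, up to but not
  including the time of the next jump. This leaves the process unconstrained after a possible
  explosion, i.e. at and after the supremum of all these times.
\<close>

definition random_walk ::
  "'w measure \<Rightarrow> (nat \<Rightarrow> real) \<Rightarrow> (real \<Rightarrow> 'w \<Rightarrow> nat) \<Rightarrow> bool" where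
  "random_walk M r Z \<longleftrightarrow>
     prob_space M \<and>
     (\<forall>t\<ge>0. Z t \<in> M \<rightarrow>\<^sub>M count_space UNIV) \<and>
     (\<exists>Y S. jump_hold_chain M r Y S \<and>
        (AE \<omega> in M. \<forall>n t. (\<Sum>k<n. S k \<omega>) \<le> t \<and> t < (\<Sum>k<Suc n. S k \<omega>) \<longrightarrow> Z t \<omega> = Y n \<omega>))"

definition jump_times :: "(real \<Rightarrow> 'w \<Rightarrow> nat) \<Rightarrow> 'w \<Rightarrow> real set" where
  "jump_times Z \<omega> = {s. 0 < s \<and> \<not> (\<forall>\<^sub>F u in at_left s. Z u \<omega> = Z s \<omega>)}"

definition non_explosive :: "'w measure \<Rightarrow> (real \<Rightarrow> 'w \<Rightarrow> nat) \<Rightarrow> bool" where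
  "non_explosive M Z \<longleftrightarrow> (AE \<omega> in M. \<forall>T. finite (jump_times Z \<omega> \<inter> {..T}))"

end

theory Submission imports Defs begin

text \<open>
  The tails \<open>F i t = P (Z t \<ge> i)\<close> solve \<open>dF i / dt = r i * (F (i - 1) - 2 * F i + F (i + 1))\<close>
  for \<open>i \<ge> 1\<close> with \<open>F 0 = 1\<close> and \<open>F i 0 = 0\<close>: they are the probabilities of having hit \<open>0\<close> by
  time \<open>t\<close> for a simple symmetric random walk started at \<open>i\<close> and run at jump rate \<open>2 * r i\<close>.
  For that walk larger rates are merely a faster clock. Analytically: by a minimum principle, which
  holds without any bound on \<open>r\<close> because \<open>i \<mapsto> i\<close> is harmonic and proper, \<open>F\<close> is increasing in
  \<open>t\<close>, so its second difference in \<open>i\<close> is nonnegative, so \<open>F\<close> is a supersolution for every smaller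
  rate function. Hence each \<open>F i t\<close>, and not only their sum \<open>E Z t\<close>, is increasing in \<open>r\<close>.

  The equation for \<open>F\<close> is the Kolmogorov forward equation in integrated form. Since the
  exponential holding time is independent of the past, the probability of having left the \<open>n\<close>-th
  visited state, and of this state being \<open>i\<close>, by time \<open>t\<close> is \<open>exit_rate r i\<close> times the expected
  time spent there during \<open>[0, t]\<close>; summing over \<open>n\<close> gives the equation.
\<close>

section \<open>The tail equation and its minimum principle\<close>

text \<open>Add the perturbation \<epsilon> * (k + 1 + t). It is affine in \<open>k\<close>, so it
  leaves second differences alone whatever the rates are; it grows in \<open>k\<close>, so a
  negative minimum can only occur at small \<open>k\<close>; it increases in \<open>t\<close>, so at
  a negative minimum the time derivative would be strictly positive and the value slightly earlier
  would be smaller still.\<close>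

lemma discrete_minimum_principle:
  fixes D D' :: "nat \<Rightarrow> real \<Rightarrow> real"
  assumes r: "\<And>i. 1 \<le> i \<Longrightarrow> 0 < r i"
    and cont: "\<And>i. continuous_on {0..} (D i)"
    and deriv: "\<And>i t. 1 \<le> i \<Longrightarrow> 0 < t \<Longrightarrow> (D i has_real_derivative D' i t) (at t)"
    and super: "\<And>i t. 1 \<le> i \<Longrightarrow> 0 < t \<Longrightarrow>
        r i * (D (i - 1) t - 2 * D i t + D (Suc i) t) \<le> D' i t"
    and bottom: "\<And>t. 0 \<le> t \<Longrightarrow> 0 \<le> D 0 t"
    and init: "\<And>i. 0 \<le> D i 0"
    and bound: "\<And>i t. 0 \<le> t \<Longrightarrow> - B \<le> D i t"
    and T: "0 \<le> T"
  shows "0 \<le> D i T"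
proof (rule field_le_epsilon)
  fix e :: real assume e: "0 < e"
  \<comment> \<open>Chosen so that the perturbation at the point \<open>(i, T)\<close> is exactly
    \<open>e\<close>.\<close>
  define \<epsilon> where "\<epsilon> = e / (real i + 1 + T)"
  have eps: "0 < \<epsilon>" using e T unfolding \<epsilon>_def by (intro divide_pos_pos) auto
  define G where "G k t = D k t + \<epsilon> * (real k + 1 + t)" for k t
  \<comment> \<open>From \<open>K\<close> on, the perturbation outweighs the lower bound
    \<open>- B\<close> at every time.\<close>
  obtain K where K: "B / \<epsilon> < real K" using reals_Archimedean2 by blast
  have far: "0 < G k t" if "K \<le> k" "0 \<le> t" for k t
  proof -
    have "B < \<epsilon> * real K" using K eps by (simp add: field_simps)
    also have "\<dots> \<le> \<epsilon> * (real k + 1 + t)" using that eps by (intro mult_left_mono) auto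
    finally show ?thesis using bound[OF that(2), of k] unfolding G_def by linarith
  qed
  have Gcont: "continuous_on {0..T} (G k)" for k
    unfolding G_def by (intro continuous_intros continuous_on_subset[OF cont]) auto
  have "\<exists>t\<in>{0..T}. \<forall>s\<in>{0..T}. G k t \<le> G k s" for k
    using continuous_attains_inf[OF _ _ Gcont, of k] T by auto
  \<comment> \<open>Minimise first over the compact time interval for each site, then over the
    finitely many sites up to \<open>K\<close>.\<close>
  then obtain \<tau> where \<tau>: "\<And>k. \<tau> k \<in> {0..T}" "\<And>k s. s \<in> {0..T} \<Longrightarrow> G k (\<tau> k) \<le> G k s"
    by metis
  obtain k where k: "k \<le> K" "\<And>l. l \<le> K \<Longrightarrow> G k (\<tau> k) \<le> G l (\<tau> l)"
    using arg_min_if_finite(1)[of "{..K}" "\<lambda>l. G l (\<tau> l)"]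
          arg_min_least[of "{..K}" _ "\<lambda>l. G l (\<tau> l)"] by fastforce
  have nonneg: "0 \<le> G k (\<tau> k)"
  proof (rule ccontr)
    assume "\<not> 0 \<le> G k (\<tau> k)"
    then have neg: "G k (\<tau> k) < 0" by simp
    have \<tau>0: "0 \<le> \<tau> k" using \<tau>(1) by auto
    have min: "G k (\<tau> k) \<le> G l s" if "s \<in> {0..T}" for l s
    proof (cases "l \<le> K")
      case True then show ?thesis using k(2) \<tau>(2)[OF that] order_trans by blast
    next
      case False then show ?thesis using far[of l s] that neg by auto
    qed
    have "0 \<le> G k 0" using init[of k] eps unfolding G_def by simp
    with neg have "\<tau> k \<noteq> 0" by auto
    then have tpos: "0 < \<tau> k" using \<tau>0 by simp
    have "k \<noteq> 0"
    proof
      assume "k = 0"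
      then have "0 \<le> G k (\<tau> k)" using bottom[OF \<tau>0] eps \<tau>0 unfolding G_def by simp
      with neg show False by simp
    qed
    then have k1: "1 \<le> k" by simp
    have dG: "(G k has_real_derivative D' k (\<tau> k) + \<epsilon>) (at (\<tau> k))"
      unfolding G_def by (rule derivative_eq_intros deriv k1 tpos refl | simp)+
    have "0 \<le> G (k - 1) (\<tau> k) - 2 * G k (\<tau> k) + G (Suc k) (\<tau> k)"
      using min[OF \<tau>(1), of "k - 1" k] min[OF \<tau>(1), of "Suc k" k] by linarith
    also have "\<dots> = D (k - 1) (\<tau> k) - 2 * D k (\<tau> k) + D (Suc k) (\<tau> k)"
      using k1 unfolding G_def by (simp add: of_nat_diff algebra_simps)
    finally have "0 \<le> D' k (\<tau> k)" using super[OF k1 tpos] r[OF k1]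
      by (meson mult_nonneg_nonneg less_imp_le order_trans)
    then have "0 < D' k (\<tau> k) + \<epsilon>" using eps by simp
    from DERIV_pos_inc_left[OF dG this] obtain d where
      d: "0 < d" "\<And>h. 0 < h \<Longrightarrow> h < d \<Longrightarrow> G k (\<tau> k - h) < G k (\<tau> k)" by blast
    \<comment> \<open>Going back by at most \<open>\<tau> k\<close> keeps the earlier time in
      \<open>{0..T}\<close>. Only a left neighbourhood is inspected, so the case
      \<open>\<tau> k = T\<close> is covered.\<close>
    define h where "h = min (d / 2) (\<tau> k)"
    have "0 < h" "h < d" "\<tau> k - h \<in> {0..T}" using d tpos \<tau>(1)[of k] unfolding h_def by auto
    with d(2) min[of "\<tau> k - h" k] show False by fastforce
  qed
  have "0 \<le> G i T"
  proof (cases "i \<le> K")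
    case True
    then show ?thesis using nonneg k(2) \<tau>(2)[of T i] T by force
  next
    case False then show ?thesis using far[of i T] T by auto
  qed
  moreover have "\<epsilon> * (real i + 1 + T) = e" using T unfolding \<epsilon>_def by (auto simp: field_simps)
  ultimately show "0 \<le> D i T + e" unfolding G_def by simp
qed

text \<open>The bounds 0 and 1 make the difference of two solutions at least -1, as the minimum
  principle requires. At time 0 the equation is replaced by continuity.\<close>

definition tail_solution :: "(nat \<Rightarrow> real) \<Rightarrow> (nat \<Rightarrow> real \<Rightarrow> real) \<Rightarrow> bool" where
  "tail_solution r F \<longleftrightarrow>
     (\<forall>i. continuous_on {0..} (F i)) \<and>
     (\<forall>i\<ge>1. \<forall>t>0. (F i has_real_derivative r i * (F (i - 1) t - 2 * F i t + F (Suc i) t)) (at t)) \<and>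
     (\<forall>t\<ge>0. F 0 t = 1) \<and> (\<forall>i\<ge>1. F i 0 = 0) \<and> (\<forall>i. \<forall>t\<ge>0. 0 \<le> F i t \<and> F i t \<le> 1)"

text \<open>The equation is linear and autonomous, so the increment over a time shift
  \<open>s\<close> solves it too. It vanishes at site 0, and at time 0 it is \<open>F i s\<close>
  for \<open>i \<ge> 1\<close>, hence nonnegative.\<close>

lemma tail_solution_mono_time:
  assumes r: "\<And>i. 1 \<le> i \<Longrightarrow> 0 < r i" and F: "tail_solution r F" and "0 \<le> s" "0 \<le> t"
  shows "F i t \<le> F i (t + s)"
proof -
  note [simp] = assms(3,4)
  have c: "\<And>i. continuous_on {0..} (F i)"
   and d: "\<And>i t. 1 \<le> i \<Longrightarrow> 0 < t \<Longrightarrow>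
      (F i has_real_derivative r i * (F (i - 1) t - 2 * F i t + F (Suc i) t)) (at t)"
   and 0: "\<And>t. 0 \<le> t \<Longrightarrow> F 0 t = 1" "\<And>i. 1 \<le> i \<Longrightarrow> F i 0 = 0"
   and b: "\<And>i t. 0 \<le> t \<Longrightarrow> 0 \<le> F i t" "\<And>i t. 0 \<le> t \<Longrightarrow> F i t \<le> 1"
    using F unfolding tail_solution_def by blast+
  have "0 \<le> F i (t + s) - F i t"
  proof (rule discrete_minimum_principle[where r = r and B = 1 and D = "\<lambda>i t. F i (t + s) - F i t"
     and D' = "\<lambda>i t. r i * (F (i - 1) (t + s) - 2 * F i (t + s) + F (Suc i) (t + s))
                    - r i * (F (i - 1) t - 2 * F i t + F (Suc i) t)"])
    fix i show "continuous_on {0..} (\<lambda>t. F i (t + s) - F i t)"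
      by (intro continuous_intros c continuous_on_compose2[OF c]) auto
  next
    fix i :: nat and t :: real assume i: "1 \<le> i" "0 < t"
    have "((\<lambda>t. F i (t + s)) has_real_derivative
       r i * (F (i - 1) (t + s) - 2 * F i (t + s) + F (Suc i) (t + s))) (at t)"
      using d[OF i(1), of "t + s"] i by (simp add: DERIV_shift add_pos_nonneg)
    then show "((\<lambda>t. F i (t + s) - F i t) has_real_derivative
       r i * (F (i - 1) (t + s) - 2 * F i (t + s) + F (Suc i) (t + s))
                    - r i * (F (i - 1) t - 2 * F i t + F (Suc i) t)) (at t)"
      by (intro DERIV_diff d i)
  next
    fix i show "0 \<le> F i (0 + s) - F i 0" using 0(1) 0(2)[of i] b(1)[of s i]
      by (cases "i = 0") auto
  next
    fix i and t :: real assume "0 \<le> t"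
    then show "- 1 \<le> F i (t + s) - F i t"  using b(1)[of "t + s" i] b(2)[of t i] by simp
  qed (use r 0 in \<open>auto simp: algebra_simps\<close>)
  then show ?thesis by simp
qed

text \<open>Times the positive rate, the second difference is the time derivative, which cannot be
  negative for a function increasing in time.\<close>

lemma tail_solution_convex:
  assumes r: "\<And>i. 1 \<le> i \<Longrightarrow> 0 < r i" and F: "tail_solution r F" and i: "1 \<le> i" and t: "0 < t"
  shows "0 \<le> F (i - 1) t - 2 * F i t + F (Suc i) t"
proof (rule ccontr)
  let ?L = "F (i - 1) t - 2 * F i t + F (Suc i) t"
  assume "\<not> 0 \<le> ?L"
  then have "r i * ?L < 0" using r[OF i] by (simp add: mult_pos_neg)
  moreover have "(F i has_real_derivative r i * ?L) (at t)"
    using F i t unfolding tail_solution_def by blast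
  ultimately obtain d where d: "0 < d" "\<And>h. 0 < h \<Longrightarrow> h < d \<Longrightarrow> F i (t + h) < F i t"
    using DERIV_neg_dec_right by metis
  then have "F i (t + d / 2) < F i t" by simp
  with tail_solution_mono_time[OF r F, of "d / 2" t i] d(1) t show False by simp
qed

text \<open>By convexity, lowering the rate from \<open>r'\<close> to \<open>r\<close> only lowers
  the right-hand side of the equation for \<open>F'\<close>. So \<open>F'\<close> is a supersolution
  for \<open>r\<close>, and the minimum principle applies to \<open>F' - F\<close>.\<close>

lemma tail_solution_mono_rate:
  assumes r: "\<And>i. 1 \<le> i \<Longrightarrow> 0 < r i" and r': "\<And>i. 1 \<le> i \<Longrightarrow> 0 < r' i"
    and le: "\<And>i. 1 \<le> i \<Longrightarrow> r i \<le> r' i"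
    and F: "tail_solution r F" and F': "tail_solution r' F'" and "0 \<le> t"
  shows "F i t \<le> F' i t"
proof -
  define L where "L F i t = (F (i - 1) t - 2 * F i t + F (Suc i) t :: real)" for F i and t :: real
  have "0 \<le> F' i t - F i t"
  proof (rule discrete_minimum_principle[where r = r and B = 1 and D = "\<lambda>i t. F' i t - F i t"
     and D' = "\<lambda>i t. r' i * L F' i t - r i * L F i t"])
    fix i :: nat and t :: real assume i: "1 \<le> i" "0 < t"
    have "0 \<le> L F' i t" unfolding L_def by (rule tail_solution_convex[OF r' F' i])
    then have "r i * L F' i t \<le> r' i * L F' i t" by (intro mult_right_mono le i)
    moreover have "(F' (i - 1) t - F (i - 1) t) - 2 * (F' i t - F i t) + (F' (Suc i) t - F (Suc i) t)
        = L F' i t - L F i t" unfolding L_def by simp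
    ultimately show "r i * ((F' (i - 1) t - F (i - 1) t) - 2 * (F' i t - F i t) +
        (F' (Suc i) t - F (Suc i) t)) \<le> r' i * L F' i t - r i * L F i t"
      by (simp add: right_diff_distrib)
  next
    fix i :: nat and t :: real assume i: "1 \<le> i" "0 < t"
    show "((\<lambda>t. F' i t - F i t) has_real_derivative r' i * L F' i t - r i * L F i t) (at t)"
      using F F' i unfolding L_def tail_solution_def by (intro DERIV_diff) auto
  next
    fix i show "continuous_on {0..} (\<lambda>t. F' i t - F i t)"
      using F F' unfolding tail_solution_def by (intro continuous_on_diff) auto
  next
    fix i show "0 \<le> F' i 0 - F i 0"
      using F F' unfolding tail_solution_def by (cases "i = 0") auto
  next
    fix i and t :: real assume "0 \<le> t"
    then have "0 \<le> F' i t" "F i t \<le> 1" using F F' unfolding tail_solution_def by blast+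
    then show "- 1 \<le> F' i t - F i t" by simp
  qed (use r \<open>0 \<le> t\<close> F F' in \<open>auto simp: tail_solution_def\<close>)
  then show ?thesis by simp
qed

section \<open>Independence of holding times and jumps from the past\<close>

context prob_space begin

text \<open>The law of \<open>X\<close> on the event \<open>P\<close>, left unnormalised so that
  events of probability 0 are no special case.\<close>

lemma emeasure_restricted_distr:
  assumes [measurable]: "Measurable.pred M P" "X \<in> M \<rightarrow>\<^sub>M N" and D: "D \<in> sets N"
  shows "emeasure (distr (density M (indicator {\<omega> \<in> space M. P \<omega>})) N X) D
    = emeasure M {\<omega> \<in> space M. P \<omega> \<and> X \<omega> \<in> D}"
proof -
  have "emeasure (distr (density M (indicator {\<omega> \<in> space M. P \<omega>})) N X) D
      = emeasure (density M (indicator {\<omega> \<in> space M. P \<omega>})) (X -` D \<inter> space M)"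
    using D by (subst emeasure_distr) auto
  also have "\<dots> = emeasure M ({\<omega> \<in> space M. P \<omega>} \<inter> (X -` D \<inter> space M))"
    using D by (intro emeasure_restricted) auto
  also have "{\<omega> \<in> space M. P \<omega>} \<inter> (X -` D \<inter> space M) = {\<omega> \<in> space M. P \<omega> \<and> X \<omega> \<in> D}" by auto
  finally show ?thesis .
qed

text \<open>Right half-lines determine a Borel measure that is finite on them.\<close>

lemma emeasure_restricted_distr_eqI:
  fixes W :: "'a \<Rightarrow> real"
  assumes [measurable]: "Measurable.pred M P" "W \<in> borel_measurable M"
    and sets: "sets K = sets borel"
    and eq: "\<And>s. emeasure M {\<omega> \<in> space M. P \<omega> \<and> s < W \<omega>} = emeasure K {s<..}"
    and B: "B \<in> sets borel"
  shows "emeasure M {\<omega> \<in> space M. P \<omega> \<and> W \<omega> \<in> B} = emeasure K B"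
proof -
  have *: "emeasure (distr (density M (indicator {\<omega> \<in> space M. P \<omega>})) borel W) {s<..} = emeasure K {s<..}" for s
    by (subst emeasure_restricted_distr) (use eq in auto)
  have "distr (density M (indicator {\<omega> \<in> space M. P \<omega>})) borel W = K"
  proof (rule measure_eqI_lessThan)
    fix s show "emeasure (distr (density M (indicator {\<omega> \<in> space M. P \<omega>})) borel W) {s<..} < \<infinity>"
      by (subst emeasure_restricted_distr) (auto simp: emeasure_eq_measure)
  qed (use sets * in auto)
  then show ?thesis using emeasure_restricted_distr[of P W borel B] B by simp
qed

text \<open>Two extension steps: for fixed \<open>C\<close>, half-lines determine the law of
  \<open>W\<close>; the resulting identity on rectangles then extends to all of the product
  \<sigma>-algebra, since rectangles form an intersection-stable generator.\<close>

lemma prob_scaled_pair: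
  fixes X W :: "'a \<Rightarrow> real"
  assumes [measurable]: "Measurable.pred M P" "Measurable.pred M Q"
      "X \<in> borel_measurable M" "W \<in> borel_measurable M"
    and c: "0 \<le> c"
    and tails: "\<And>C s. C \<in> sets borel \<Longrightarrow>
      prob {\<omega> \<in> space M. Q \<omega> \<and> X \<omega> \<in> C \<and> s < W \<omega>} =
      c * prob {\<omega> \<in> space M. P \<omega> \<and> X \<omega> \<in> C \<and> s < W \<omega>}"
    and D: "D \<in> sets (borel \<Otimes>\<^sub>M borel)"
  shows "prob {\<omega> \<in> space M. Q \<omega> \<and> (X \<omega>, W \<omega>) \<in> D} = c * prob {\<omega> \<in> space M. P \<omega> \<and> (X \<omega>, W \<omega>) \<in> D}"
proof -
  have rect: "emeasure M {\<omega> \<in> space M. (Q \<omega> \<and> X \<omega> \<in> C) \<and> W \<omega> \<in> B}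
     = ennreal c * emeasure M {\<omega> \<in> space M. (P \<omega> \<and> X \<omega> \<in> C) \<and> W \<omega> \<in> B}"
    if [measurable]: "C \<in> sets borel" and B: "B \<in> sets borel" for B C
  proof -
    define K where "K = scale_measure (ennreal c)
        (distr (density M (indicator {\<omega> \<in> space M. P \<omega> \<and> X \<omega> \<in> C})) borel W)"
    have K: "emeasure K B = ennreal c * emeasure M {\<omega> \<in> space M. (P \<omega> \<and> X \<omega> \<in> C) \<and> W \<omega> \<in> B}"
      if "B \<in> sets borel" for B
      unfolding K_def using that by (simp add: emeasure_restricted_distr)
    have "emeasure M {\<omega> \<in> space M. (Q \<omega> \<and> X \<omega> \<in> C) \<and> W \<omega> \<in> B} = emeasure K B"
    proof (rule emeasure_restricted_distr_eqI)
      fix s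
      show "emeasure M {\<omega> \<in> space M. (Q \<omega> \<and> X \<omega> \<in> C) \<and> s < W \<omega>} = emeasure K {s<..}"
        using tails[of C s] c by (simp add: K emeasure_eq_measure ennreal_mult[symmetric] conj_assoc)
    qed (use B in \<open>auto simp: K_def\<close>)
    with K[OF B] show ?thesis by simp
  qed
  define L1 where "L1 = distr (density M (indicator {\<omega> \<in> space M. Q \<omega>})) (borel \<Otimes>\<^sub>M borel) (\<lambda>\<omega>. (X \<omega>, W \<omega>))"
  define L2 where "L2 = scale_measure (ennreal c)
     (distr (density M (indicator {\<omega> \<in> space M. P \<omega>})) (borel \<Otimes>\<^sub>M borel) (\<lambda>\<omega>. (X \<omega>, W \<omega>)))"
  have L1: "emeasure L1 D = emeasure M {\<omega> \<in> space M. Q \<omega> \<and> (X \<omega>, W \<omega>) \<in> D}"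
    if "D \<in> sets (borel \<Otimes>\<^sub>M borel)" for D
    unfolding L1_def using that by (subst emeasure_restricted_distr) auto
  have L2: "emeasure L2 D = ennreal c * emeasure M {\<omega> \<in> space M. P \<omega> \<and> (X \<omega>, W \<omega>) \<in> D}"
    if "D \<in> sets (borel \<Otimes>\<^sub>M borel)" for D
    unfolding L2_def using that by (simp, subst emeasure_restricted_distr) auto
  have "L1 = L2"
  proof (rule measure_eqI_generator_eq[OF Int_stable_pair_measure_generator[of borel borel], where A = "\<lambda>_. UNIV"])
    fix R :: "(real \<times> real) set" assume "R \<in> {a \<times> b |a b. a \<in> sets borel \<and> b \<in> sets borel}"
    then obtain C B where R: "R = C \<times> B" and CB: "C \<in> sets borel" "B \<in> sets borel" by blast
    then have "R \<in> sets (borel \<Otimes>\<^sub>M borel)" by simp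
    with rect[OF CB] show "emeasure L1 R = emeasure L2 R" by (simp add: L1 L2 R conj_assoc)
  next
    show "range (\<lambda>_. UNIV) \<subseteq> {a \<times> b |a b. a \<in> sets borel \<and> b \<in> sets (borel :: real measure)}"
      by (auto intro!: exI[of _ UNIV])
    show "emeasure L1 UNIV \<noteq> \<infinity>" 
      using sets.top[of "borel \<Otimes>\<^sub>M borel :: (real \<times> real) measure"]
      by (subst L1) (simp_all add: space_pair_measure emeasure_eq_measure)
  qed (auto simp: L1_def L2_def sets_pair_measure)
  then have "emeasure L1 D = emeasure L2 D" by simp
  then have "ennreal (prob {\<omega> \<in> space M. Q \<omega> \<and> (X \<omega>, W \<omega>) \<in> D})
     = ennreal (c * prob {\<omega> \<in> space M. P \<omega> \<and> (X \<omega>, W \<omega>) \<in> D})"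
    using c by (simp add: L1[OF D] L2[OF D] emeasure_eq_measure ennreal_mult[symmetric])
  then show ?thesis using c by (simp add: mult_nonneg_nonneg)
qed

lemma prob_scaled_fibres:
  fixes H :: "'a \<Rightarrow> 'b :: countable"
  assumes [measurable]: "H \<in> M \<rightarrow>\<^sub>M count_space UNIV" "Measurable.pred M P" "Measurable.pred M Q"
    and c: "0 \<le> c"
    and fibre: "\<And>h. prob {\<omega> \<in> space M. H \<omega> = h \<and> Q \<omega>} = c * prob {\<omega> \<in> space M. H \<omega> = h \<and> P \<omega>}"
  shows "prob {\<omega> \<in> space M. Q \<omega>} = c * prob {\<omega> \<in> space M. P \<omega>}"
proof -
  have split: "emeasure M {\<omega> \<in> space M. R \<omega>} = (\<integral>\<^sup>+h. emeasure M {\<omega> \<in> space M. H \<omega> = h \<and> R \<omega>} \<partial>count_space UNIV)"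
    if [measurable]: "Measurable.pred M R" for R
  proof -
    have "{\<omega> \<in> space M. R \<omega>} = (\<Union>h. {\<omega> \<in> space M. H \<omega> = h \<and> R \<omega>})" by auto
    then show ?thesis by (simp, subst emeasure_UN_countable) (auto simp: disjoint_family_on_def)
  qed
  have "ennreal (prob {\<omega> \<in> space M. Q \<omega>}) = ennreal c * ennreal (prob {\<omega> \<in> space M. P \<omega>})"
    using split[of Q] split[of P] c
    by (simp add: emeasure_eq_measure fibre ennreal_mult nn_integral_cmult)
  then show ?thesis using c by (simp add: ennreal_mult[symmetric] mult_nonneg_nonneg)
qed

end

section \<open>The jump chain and its holding times\<close>

locale walk = prob_space M for M :: "'w measure" +
  fixes r :: "nat \<Rightarrow> real" and Y :: "nat \<Rightarrow> 'w \<Rightarrow> nat" and S :: "nat \<Rightarrow> 'w \<Rightarrow> real"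
  assumes rate_pos: "\<And>i. 1 \<le> i \<Longrightarrow> 0 < r i" and chain: "jump_hold_chain M r Y S"
begin

lemma Y_measurable[measurable]: "Y n \<in> M \<rightarrow>\<^sub>M count_space UNIV"
  and S_measurable[measurable]: "S n \<in> borel_measurable M"
  using chain unfolding jump_hold_chain_def by blast+

definition jump_time :: "nat \<Rightarrow> 'w \<Rightarrow> real" where "jump_time n \<omega> = (\<Sum>k<n. S k \<omega>)"

lemma jump_time_0[simp]: "jump_time 0 \<omega> = 0" and jump_time_Suc: "jump_time (Suc n) \<omega> = jump_time n \<omega> + S n \<omega>"
  by (simp_all add: jump_time_def)

lemma jump_time_measurable[measurable]: "jump_time n \<in> borel_measurable M"
  unfolding jump_time_def by measurable

lemma exit_rate_pos: "0 < exit_rate r i"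
proof -
  have "0 < jump_rate r i (Suc i)" using rate_pos by (simp add: jump_rate_def)
  moreover have "jump_rate r i j \<ge> 0" for j
    using rate_pos[of i] rate_pos[of j] by (auto simp: jump_rate_def less_imp_le)
  ultimately show ?thesis unfolding exit_rate_def by (intro sum_pos2[of _ "Suc i"]) auto
qed

lemma jump_rate_nonneg: "0 \<le> jump_rate r i j"
  using rate_pos[of i] rate_pos[of j] by (auto simp: jump_rate_def less_imp_le)

lemma prob_path:
  "prob {\<omega> \<in> space M. \<forall>k\<le>n. Y k \<omega> = y k} =
        (if y 0 = 0 then 1 else 0) *
        (\<Prod>k<n. jump_rate r (y k) (y (Suc k)) / exit_rate r (y k))"
  using chain unfolding jump_hold_chain_def by blast

lemma prob_path_tails_full:
  "\<forall>k\<le>n. 0 \<le> s k \<Longrightarrow> prob {\<omega> \<in> space M. \<forall>k\<le>n. Y k \<omega> = y k \<and> s k < S k \<omega>} =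
        prob {\<omega> \<in> space M. \<forall>k\<le>n. Y k \<omega> = y k} *
        (\<Prod>k\<le>n. exp (- exit_rate r (y k) * s k))"
  using chain unfolding jump_hold_chain_def by blast

text \<open>There are uncountably many functions \<open>y\<close> but only countably many lists, so
  the null sets are collected over lists recording the first \<open>n + 1\<close> states.\<close>

lemma AE_path:
  assumes "\<And>y. AE \<omega> in M. (\<forall>k\<le>n. Y k \<omega> = y k) \<longrightarrow> P \<omega>"
  shows "AE \<omega> in M. P \<omega>"
proof -
  have "AE \<omega> in M. \<forall>ys::nat list. (\<forall>k\<le>n. Y k \<omega> = ys ! k) \<longrightarrow> P \<omega>"
    unfolding AE_all_countable using assms by blast
  then show ?thesis
  proof eventually_elim
    case (elim \<omega>)
    have "\<forall>k\<le>n. Y k \<omega> = map (\<lambda>k. Y k \<omega>) [0..<Suc n] ! k" by (simp del: upt_Suc)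
    with elim show ?case by blast
  qed
qed

text \<open>With all thresholds 0 the exponential factors are 1, so requiring positive holding times
  costs no probability on any path.\<close>

lemma AE_S_pos: "AE \<omega> in M. \<forall>k. 0 < S k \<omega>"
  unfolding AE_all_countable
proof
  fix n
  show "AE \<omega> in M. 0 < S n \<omega>"
  proof (rule AE_path[of n])
    fix y :: "nat \<Rightarrow> nat"
    let ?A = "{\<omega> \<in> space M. \<forall>k\<le>n. Y k \<omega> = y k}"
    let ?B = "{\<omega> \<in> space M. \<forall>k\<le>n. Y k \<omega> = y k \<and> 0 < S k \<omega>}"
    have "prob (?A - ?B) = prob ?A - prob ?B" by (rule finite_measure_Diff) auto
    also have "\<dots> = 0" using prob_path_tails_full[of n "\<lambda>_. 0" y] by simp
    finally have "emeasure M (?A - ?B) = 0" by (simp add: emeasure_eq_measure)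
    then have "AE \<omega> in M. \<omega> \<notin> ?A - ?B" by (subst AE_iff_measurable[of "?A - ?B"]) auto
    then show "AE \<omega> in M. (\<forall>k\<le>n. Y k \<omega> = y k) \<longrightarrow> 0 < S n \<omega>"
      using AE_space by eventually_elim auto
  qed
qed

text \<open>A path that makes a forbidden step has a zero factor in its probability.\<close>

lemma AE_jump: "AE \<omega> in M. \<forall>n. jump_rate r (Y n \<omega>) (Y (Suc n) \<omega>) \<noteq> 0"
  unfolding AE_all_countable
proof
  fix n
  show "AE \<omega> in M. jump_rate r (Y n \<omega>) (Y (Suc n) \<omega>) \<noteq> 0"
  proof (rule AE_path[of "Suc n"])
    fix y :: "nat \<Rightarrow> nat"
    let ?A = "{\<omega> \<in> space M. \<forall>k\<le>Suc n. Y k \<omega> = y k}"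
    show "AE \<omega> in M. (\<forall>k\<le>Suc n. Y k \<omega> = y k) \<longrightarrow> jump_rate r (Y n \<omega>) (Y (Suc n) \<omega>) \<noteq> 0"
    proof (cases "jump_rate r (y n) (y (Suc n)) = 0")
      case True
      then have "prob ?A = 0" by (subst prob_path) simp
      then have "emeasure M ?A = 0" by (simp add: emeasure_eq_measure)
      then have "AE \<omega> in M. \<omega> \<notin> ?A" by (subst AE_iff_measurable[of ?A]) auto
      then show ?thesis using AE_space by eventually_elim blast
    qed auto
  qed
qed

lemma AE_Y_0: "AE \<omega> in M. Y 0 \<omega> = 0"
proof -
  have "prob {\<omega> \<in> space M. Y 0 \<omega> = 0} = 1" using prob_path[of 0 "\<lambda>_. 0"] by simp
  then show ?thesis by (subst (asm) prob_Collect_eq_1) auto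
qed

text \<open>Pad with threshold 0 from index \<open>N\<close> on: almost surely this is no
  restriction, and it contributes factors 1.\<close>

lemma prob_path_tails:
  assumes N: "N \<le> Suc n" and s: "\<And>k. k < N \<Longrightarrow> 0 \<le> s k"
  shows "prob {\<omega> \<in> space M. (\<forall>k\<le>n. Y k \<omega> = y k) \<and> (\<forall>k<N. s k < S k \<omega>)} =
        prob {\<omega> \<in> space M. \<forall>k\<le>n. Y k \<omega> = y k} * (\<Prod>k<N. exp (- exit_rate r (y k) * s k))"
proof -
  define s' where "s' k = (if k < N then s k else 0)" for k
  have "prob {\<omega> \<in> space M. (\<forall>k\<le>n. Y k \<omega> = y k) \<and> (\<forall>k<N. s k < S k \<omega>)}
     = prob {\<omega> \<in> space M. \<forall>k\<le>n. Y k \<omega> = y k \<and> s' k < S k \<omega>}"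
  proof (rule finite_measure_eq_AE)
    show "AE \<omega> in M. (\<omega> \<in> {\<omega> \<in> space M. (\<forall>k\<le>n. Y k \<omega> = y k) \<and> (\<forall>k<N. s k < S k \<omega>)}) =
      (\<omega> \<in> {\<omega> \<in> space M. \<forall>k\<le>n. Y k \<omega> = y k \<and> s' k < S k \<omega>})"
      using AE_S_pos by eventually_elim (use N in \<open>auto simp: s'_def\<close>)
  qed auto
  also have "\<dots> = prob {\<omega> \<in> space M. \<forall>k\<le>n. Y k \<omega> = y k} * (\<Prod>k\<le>n. exp (- exit_rate r (y k) * s' k))"
    by (rule prob_path_tails_full) (use s in \<open>auto simp: s'_def\<close>)
  also have "(\<Prod>k\<le>n. exp (- exit_rate r (y k) * s' k)) = (\<Prod>k<N. exp (- exit_rate r (y k) * s k))"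
    using N by (intro prod.mono_neutral_cong_right) (auto simp: s'_def)
  finally show ?thesis .
qed

text \<open>Passes from joint tails to the law of the sum without computing a convolution: the
  holding times are absorbed into the sum one at a time, those from index \<open>m\<close> on still
  being described by their tails.\<close>

lemma prob_scaled_jump_time:
  assumes [measurable]: "Measurable.pred M P" "Measurable.pred M Q" and c: "0 \<le> c"
    and tails: "\<And>s. (\<And>k. k < N \<Longrightarrow> 0 \<le> s k) \<Longrightarrow>
       prob {\<omega> \<in> space M. Q \<omega> \<and> (\<forall>k<N. s k < S k \<omega>)} = c * prob {\<omega> \<in> space M. P \<omega> \<and> (\<forall>k<N. s k < S k \<omega>)}"
    and C: "C \<in> sets borel"
  shows "prob {\<omega> \<in> space M. Q \<omega> \<and> jump_time N \<omega> \<in> C} = c * prob {\<omega> \<in> space M. P \<omega> \<and> jump_time N \<omega> \<in> C}"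
proof -
  have "prob {\<omega> \<in> space M. (Q \<omega> \<and> (\<forall>k\<in>{m..<N}. s k < S k \<omega>)) \<and> jump_time m \<omega> \<in> C} =
     c * prob {\<omega> \<in> space M. (P \<omega> \<and> (\<forall>k\<in>{m..<N}. s k < S k \<omega>)) \<and> jump_time m \<omega> \<in> C}"
    if "m \<le> N" "\<And>k. k < N \<Longrightarrow> 0 \<le> s k" "C \<in> sets borel" for m s C
    using that
  proof (induction m arbitrary: s C)
    case 0
    \<comment> \<open>The empty sum is 0, so the condition on \<open>jump_time 0\<close> is either
      certain or impossible.\<close>
    then show ?case using tails[of s] by (cases "0 \<in> C") (auto simp: atLeast0LessThan Ball_def)
  next
    case (Suc m)
    note [measurable] = \<open>C \<in> sets borel\<close>
    have D: "{p. fst p + snd p \<in> C} \<in> sets (borel \<Otimes>\<^sub>M borel :: (real \<times> real) measure)"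
      using measurable_sets[of "\<lambda>p. fst p + snd p" "borel \<Otimes>\<^sub>M borel" borel C]
      by (simp add: vimage_def space_pair_measure)
    have "prob {\<omega> \<in> space M. (Q \<omega> \<and> (\<forall>k\<in>{Suc m..<N}. s k < S k \<omega>)) \<and>
        (jump_time m \<omega>, S m \<omega>) \<in> {p. fst p + snd p \<in> C}} =
     c * prob {\<omega> \<in> space M. (P \<omega> \<and> (\<forall>k\<in>{Suc m..<N}. s k < S k \<omega>)) \<and>
        (jump_time m \<omega>, S m \<omega>) \<in> {p. fst p + snd p \<in> C}}"
    proof (rule prob_scaled_pair[OF _ _ _ _ c _ D])
      fix B :: "real set" and u :: real assume B[measurable]: "B \<in> sets borel"
      \<comment> \<open>The tail assumption covers nonnegative thresholds only; a negative
        \<open>u\<close> can be raised to 0 because holding times are almost surely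
        positive.\<close>
      let ?s = "s(m := max u 0)"
      have *: "prob {\<omega> \<in> space M. (R \<omega> \<and> (\<forall>k\<in>{Suc m..<N}. s k < S k \<omega>)) \<and> jump_time m \<omega> \<in> B \<and> u < S m \<omega>}
         = prob {\<omega> \<in> space M. (R \<omega> \<and> (\<forall>k\<in>{m..<N}. ?s k < S k \<omega>)) \<and> jump_time m \<omega> \<in> B}"
        if [measurable]: "Measurable.pred M R" for R
      proof (rule finite_measure_eq_AE)
        have eq: "{m..<N} = insert m {Suc m..<N}" using Suc.prems(1) by auto
        show "AE \<omega> in M. (\<omega> \<in> {\<omega> \<in> space M. (R \<omega> \<and> (\<forall>k\<in>{Suc m..<N}. s k < S k \<omega>)) \<and> jump_time m \<omega> \<in> B \<and> u < S m \<omega>})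
          = (\<omega> \<in> {\<omega> \<in> space M. (R \<omega> \<and> (\<forall>k\<in>{m..<N}. ?s k < S k \<omega>)) \<and> jump_time m \<omega> \<in> B})"
          using AE_S_pos by eventually_elim (auto simp: eq)
      qed auto
      show "prob {\<omega> \<in> space M. (Q \<omega> \<and> (\<forall>k\<in>{Suc m..<N}. s k < S k \<omega>)) \<and> jump_time m \<omega> \<in> B \<and> u < S m \<omega>}
         = c * prob {\<omega> \<in> space M. (P \<omega> \<and> (\<forall>k\<in>{Suc m..<N}. s k < S k \<omega>)) \<and> jump_time m \<omega> \<in> B \<and> u < S m \<omega>}"
        unfolding *[OF assms(1)] *[OF assms(2)]
        by (rule Suc.IH) (use Suc.prems B in auto)
    qed measurable
    then show ?case by (simp add: jump_time_Suc)
  qed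
  from this[of N "\<lambda>_. 0" C] C show ?thesis by simp
qed

text \<open>The path so far as a value in a countable type, so that probabilities can be summed over
  it.\<close>

definition history :: "nat \<Rightarrow> 'w \<Rightarrow> nat list" where
  "history n \<omega> = map (\<lambda>k. Y k \<omega>) [0..<Suc n]"

lemma history_measurable[measurable]: "history n \<in> M \<rightarrow>\<^sub>M count_space UNIV"
proof (induction n)
  case 0
  have "history 0 = (\<lambda>\<omega>. [Y 0 \<omega>])" by (auto simp: history_def)
  then show ?case by simp
next
  case (Suc n)
  have "history (Suc n) = (\<lambda>\<omega>. history n \<omega> @ [Y (Suc n) \<omega>])" by (auto simp: history_def)
  with Suc show ?case by simp
qed

lemma history_eq_iff: "length h = Suc n \<Longrightarrow> history n \<omega> = h \<longleftrightarrow> (\<forall>k\<le>n. Y k \<omega> = h ! k)"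
  unfolding history_def by (auto simp: list_eq_iff_nth_eq less_Suc_eq_le simp del: upt_Suc)

lemma length_history: "length (history n \<omega>) = Suc n"
  by (simp add: history_def)

lemma prob_scaled_given_Y:
  assumes [measurable]: "Measurable.pred M P" "Measurable.pred M Q" and c: "0 \<le> c"
    and path: "\<And>y. y n = i \<Longrightarrow> prob {\<omega> \<in> space M. (\<forall>k\<le>n. Y k \<omega> = y k) \<and> Q \<omega>} =
        c * prob {\<omega> \<in> space M. (\<forall>k\<le>n. Y k \<omega> = y k) \<and> P \<omega>}"
  shows "prob {\<omega> \<in> space M. Y n \<omega> = i \<and> Q \<omega>} = c * prob {\<omega> \<in> space M. Y n \<omega> = i \<and> P \<omega>}"
proof (rule prob_scaled_fibres[where H = "history n"])
  fix h
  show "prob {\<omega> \<in> space M. history n \<omega> = h \<and> Y n \<omega> = i \<and> Q \<omega>} =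
        c * prob {\<omega> \<in> space M. history n \<omega> = h \<and> Y n \<omega> = i \<and> P \<omega>}"
  proof (cases "length h = Suc n \<and> h ! n = i")
    case True
    then have "{\<omega> \<in> space M. history n \<omega> = h \<and> Y n \<omega> = i \<and> R \<omega>} =
      {\<omega> \<in> space M. (\<forall>k\<le>n. Y k \<omega> = h ! k) \<and> R \<omega>}" for R
      by (auto simp: history_eq_iff)
    with path[of "\<lambda>k. h ! k"] True show ?thesis by simp
  next
    case False
    then have "{\<omega> \<in> space M. history n \<omega> = h \<and> Y n \<omega> = i \<and> R \<omega>} = {}" for R
      by (auto simp: length_history history_def simp del: upt_Suc)
    then show ?thesis by (simp only: measure_empty mult_zero_right)
  qed
qed (use c in auto)

text \<open>On a fixed path the tail probabilities factorise, and the holding time with index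
  \<open>n\<close> contributes a factor that depends only on the state \<open>i\<close>.\<close>

lemma prob_holding_tail:
  assumes [measurable]: "C \<in> sets borel" and s: "0 \<le> s"
  shows "prob {\<omega> \<in> space M. Y n \<omega> = i \<and> jump_time n \<omega> \<in> C \<and> s < S n \<omega>} =
     exp (- exit_rate r i * s) * prob {\<omega> \<in> space M. Y n \<omega> = i \<and> jump_time n \<omega> \<in> C}"
proof (rule prob_scaled_given_Y)
  fix y :: "nat \<Rightarrow> nat" assume i: "y n = i"
  have "prob {\<omega> \<in> space M. ((\<forall>k\<le>n. Y k \<omega> = y k) \<and> s < S n \<omega>) \<and> jump_time n \<omega> \<in> C} =
    exp (- exit_rate r i * s) * prob {\<omega> \<in> space M. (\<forall>k\<le>n. Y k \<omega> = y k) \<and> jump_time n \<omega> \<in> C}"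
  proof (rule prob_scaled_jump_time)
    fix u :: "nat \<Rightarrow> real" assume u: "\<And>k. k < n \<Longrightarrow> 0 \<le> u k"
    have "prob {\<omega> \<in> space M. ((\<forall>k\<le>n. Y k \<omega> = y k) \<and> s < S n \<omega>) \<and> (\<forall>k<n. u k < S k \<omega>)} =
      prob {\<omega> \<in> space M. (\<forall>k\<le>n. Y k \<omega> = y k) \<and> (\<forall>k<Suc n. (u(n := s)) k < S k \<omega>)}"
      by (intro arg_cong[where f = prob]) (auto simp: less_Suc_eq)
    also have "\<dots> = prob {\<omega> \<in> space M. \<forall>k\<le>n. Y k \<omega> = y k} *
        (\<Prod>k<Suc n. exp (- exit_rate r (y k) * (u(n := s)) k))"
      by (rule prob_path_tails) (use u s in auto)
    also have "\<dots> = exp (- exit_rate r i * s) *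
        prob {\<omega> \<in> space M. (\<forall>k\<le>n. Y k \<omega> = y k) \<and> (\<forall>k<n. u k < S k \<omega>)}"
      using u i by (simp add: prob_path_tails)
    finally show "prob {\<omega> \<in> space M. ((\<forall>k\<le>n. Y k \<omega> = y k) \<and> s < S n \<omega>) \<and> (\<forall>k<n. u k < S k \<omega>)} =
       exp (- exit_rate r i * s) * prob {\<omega> \<in> space M. (\<forall>k\<le>n. Y k \<omega> = y k) \<and> (\<forall>k<n. u k < S k \<omega>)}" .
  qed auto
  then show "prob {\<omega> \<in> space M. (\<forall>k\<le>n. Y k \<omega> = y k) \<and> jump_time n \<omega> \<in> C \<and> s < S n \<omega>} =
    exp (- exit_rate r i * s) * prob {\<omega> \<in> space M. (\<forall>k\<le>n. Y k \<omega> = y k) \<and> jump_time n \<omega> \<in> C}"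
    by (simp add: conj_ac)
qed auto

text \<open>Extending a path by one step multiplies its probability by the transition probability
  and leaves the tail factors of the holding times before that step unchanged.\<close>

lemma prob_jump:
  assumes [measurable]: "C \<in> sets borel"
  shows "prob {\<omega> \<in> space M. Y n \<omega> = i \<and> Y (Suc n) \<omega> = j \<and> jump_time (Suc n) \<omega> \<in> C} =
     jump_rate r i j / exit_rate r i * prob {\<omega> \<in> space M. Y n \<omega> = i \<and> jump_time (Suc n) \<omega> \<in> C}"
proof (rule prob_scaled_given_Y)
  show nn: "0 \<le> jump_rate r i j / exit_rate r i"
    using jump_rate_nonneg[of i j] exit_rate_pos[of i] by simp
  fix y :: "nat \<Rightarrow> nat" assume i: "y n = i"
  have "prob {\<omega> \<in> space M. ((\<forall>k\<le>n. Y k \<omega> = y k) \<and> Y (Suc n) \<omega> = j) \<and> jump_time (Suc n) \<omega> \<in> C} =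
    jump_rate r i j / exit_rate r i * prob {\<omega> \<in> space M. (\<forall>k\<le>n. Y k \<omega> = y k) \<and> jump_time (Suc n) \<omega> \<in> C}"
  proof (rule prob_scaled_jump_time)
    fix u :: "nat \<Rightarrow> real" assume u: "\<And>k. k < Suc n \<Longrightarrow> 0 \<le> u k"
    let ?y = "y(Suc n := j)"
    have "prob {\<omega> \<in> space M. ((\<forall>k\<le>n. Y k \<omega> = y k) \<and> Y (Suc n) \<omega> = j) \<and> (\<forall>k<Suc n. u k < S k \<omega>)} =
      prob {\<omega> \<in> space M. (\<forall>k\<le>Suc n. Y k \<omega> = ?y k) \<and> (\<forall>k<Suc n. u k < S k \<omega>)}"
      by (intro arg_cong[where f = prob]) (auto simp: le_Suc_eq)
    also have "\<dots> = prob {\<omega> \<in> space M. \<forall>k\<le>Suc n. Y k \<omega> = ?y k} * (\<Prod>k<Suc n. exp (- exit_rate r (?y k) * u k))"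
      by (rule prob_path_tails) (use u in auto)
    \<comment> \<open>The indices stop at \<open>n\<close>, so the new state \<open>j\<close> enters
      no exponential factor.\<close>
    also have "(\<Prod>k<Suc n. exp (- exit_rate r (?y k) * u k)) = (\<Prod>k<Suc n. exp (- exit_rate r (y k) * u k))"
      by (intro prod.cong) auto
    also have "prob {\<omega> \<in> space M. \<forall>k\<le>Suc n. Y k \<omega> = ?y k} =
        jump_rate r i j / exit_rate r i * prob {\<omega> \<in> space M. \<forall>k\<le>n. Y k \<omega> = y k}"
    proof -
      have "(\<Prod>k<n. jump_rate r (?y k) (?y (Suc k)) / exit_rate r (?y k)) =
         (\<Prod>k<n. jump_rate r (y k) (y (Suc k)) / exit_rate r (y k))"
        by (intro prod.cong) auto
      then show ?thesis unfolding prob_path prod.lessThan_Suc using i by simp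
    qed
    finally show "prob {\<omega> \<in> space M. ((\<forall>k\<le>n. Y k \<omega> = y k) \<and> Y (Suc n) \<omega> = j) \<and> (\<forall>k<Suc n. u k < S k \<omega>)} =
      jump_rate r i j / exit_rate r i *
      prob {\<omega> \<in> space M. (\<forall>k\<le>n. Y k \<omega> = y k) \<and> (\<forall>k<Suc n. u k < S k \<omega>)}"
      using u by (simp add: prob_path_tails)
  qed (use nn in auto)
  then show "prob {\<omega> \<in> space M. (\<forall>k\<le>n. Y k \<omega> = y k) \<and> Y (Suc n) \<omega> = j \<and> jump_time (Suc n) \<omega> \<in> C} =
    jump_rate r i j / exit_rate r i * prob {\<omega> \<in> space M. (\<forall>k\<le>n. Y k \<omega> = y k) \<and> jump_time (Suc n) \<omega> \<in> C}"
    by (simp add: conj_ac)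
qed auto

end

section \<open>The forward equation\<close>

lemma exponential_tail:
  assumes q: "0 < q"
  shows "emeasure (density lborel (exponential_density q)) {s<..} = ennreal (exp (- q * max s 0))"
    and "emeasure (density lborel (exponential_density q)) {..s} = ennreal (1 - exp (- q * max s 0))"
proof -
  interpret E: prob_space "density lborel (exponential_density q)"
    by (rule prob_space_exponential_density[OF q])
  have "exponential_density q \<in> borel_measurable borel" by measurable
  then have D: "distributed (density lborel (exponential_density q)) lborel (\<lambda>x. x) (exponential_density q)"
    unfolding distributed_def by (auto simp: distr_id2)
  have le: "E.prob {..s} = 1 - exp (- q * max s 0)"
  proof (cases "0 \<le> s")
    case True
    with E.exponential_distributedD_le[OF D True q] show ?thesis
      by (simp add: max_def mult.commute atMost_def)
  next
    case False
    have "E.prob {..s} \<le> E.prob {..0}" using False by (intro E.finite_measure_mono) auto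
    also have "\<dots> = 0" using E.exponential_distributedD_le[OF D order_refl q] by (simp add: atMost_def)
    finally show ?thesis using False by (simp add: max_def measure_le_0_iff)
  qed
  then show "emeasure (density lborel (exponential_density q)) {..s} = ennreal (1 - exp (- q * max s 0))"
    by (simp add: E.emeasure_eq_measure)
  have "{s<..} = space (density lborel (exponential_density q)) - {..s}" by auto
  then have "E.prob {s<..} = 1 - E.prob {..s}" by (simp add: E.prob_compl del: space_density)
  with le show "emeasure (density lborel (exponential_density q)) {s<..} = ennreal (exp (- q * max s 0))"
    by (simp add: E.emeasure_eq_measure)
qed

text \<open>For a visit starting at time \<open>x\<close>, the rate times the expected time spent
  there up to \<open>t\<close> equals the probability that the visit has ended by
  \<open>t\<close>.\<close>

lemma nn_integral_exp_decay:
  assumes q: "0 < q" and x: "0 \<le> x"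
  shows "ennreal q * (\<integral>\<^sup>+s. indicator {0..t} s * (indicator {x..} s * ennreal (exp (- q * (s - x)))) \<partial>lborel)
    = indicator {..t} x * ennreal (1 - exp (- q * (t - x)))"
proof (cases "x \<le> t")
  case True
  have "(\<integral>\<^sup>+s. ennreal (q * exp (- q * (s - x))) * indicator {x..t} s \<partial>lborel) =
    ennreal ((- exp (- q * (t - x))) - (- exp (- q * (x - x))))"
    by (rule nn_integral_FTC_Icc)
       (use q True in \<open>auto intro!: derivative_eq_intros\<close>)
  moreover have "(\<integral>\<^sup>+s. ennreal (q * exp (- q * (s - x))) * indicator {x..t} s \<partial>lborel) =
    (\<integral>\<^sup>+s. ennreal q * (indicator {0..t} s * (indicator {x..} s * ennreal (exp (- q * (s - x))))) \<partial>lborel)"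
    using q x by (intro nn_integral_cong) (auto simp: indicator_def ennreal_mult)
  ultimately show ?thesis using True by (simp add: nn_integral_cmult)
next
  case False
  then have zero: "indicator {0..t} s * (indicator {x..} s * ennreal (exp (- q * (s - x)))) = 0" for s
    by (auto simp: indicator_def)
  show ?thesis unfolding zero using False by simp
qed

section \<open>Balance of arrivals and departures at the visited states\<close>

context walk
begin

lemma AE_jump_time_nonneg: "AE \<omega> in M. \<forall>n. 0 \<le> jump_time n \<omega>"
  using AE_S_pos by eventually_elim (simp add: jump_time_def sum_nonneg less_imp_le)

text \<open>On the event \<open>Y n \<omega> = i\<close> the arrival time and the holding time are
  independent: the holding tails factor out, and rectangles determine the joint law.\<close>

lemma joint_law_jump_hold:
  fixes n i
  defines "N \<equiv> density M (indicator {\<omega> \<in> space M. Y n \<omega> = i})"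
  defines "\<nu> \<equiv> distr N borel (jump_time n)"
  defines "\<kappa> \<equiv> density lborel (exponential_density (exit_rate r i))"
  shows "\<nu> \<Otimes>\<^sub>M \<kappa> = distr N (borel \<Otimes>\<^sub>M borel) (\<lambda>\<omega>. (jump_time n \<omega>, S n \<omega>))"
    and "finite_measure \<nu>" and "prob_space \<kappa>"
proof -
  have \<nu>: "emeasure \<nu> C = emeasure M {\<omega> \<in> space M. Y n \<omega> = i \<and> jump_time n \<omega> \<in> C}"
    if "C \<in> sets borel" for C
    unfolding \<nu>_def N_def using that by (subst emeasure_restricted_distr) auto
  show fin: "finite_measure \<nu>"
    by (rule finite_measureI) (use \<nu>[of UNIV] in \<open>simp add: \<nu>_def emeasure_eq_measure\<close>)
  show \<kappa>: "prob_space \<kappa>"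
    unfolding \<kappa>_def by (rule prob_space_exponential_density[OF exit_rate_pos])
  interpret \<nu>: finite_measure \<nu> by fact
  interpret \<kappa>: prob_space \<kappa> by fact
  show "\<nu> \<Otimes>\<^sub>M \<kappa> = distr N (borel \<Otimes>\<^sub>M borel) (\<lambda>\<omega>. (jump_time n \<omega>, S n \<omega>))"
  proof (rule pair_measure_eqI)
    show "sets (\<nu> \<Otimes>\<^sub>M \<kappa>) = sets (distr N (borel \<Otimes>\<^sub>M borel) (\<lambda>\<omega>. (jump_time n \<omega>, S n \<omega>)))"
      unfolding \<nu>_def \<kappa>_def by simp
    fix C B assume "C \<in> sets \<nu>" "B \<in> sets \<kappa>"
    then have C[measurable]: "C \<in> sets borel" and B[measurable]: "B \<in> sets borel"
      unfolding \<nu>_def \<kappa>_def by auto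
    have "emeasure M {\<omega> \<in> space M. (Y n \<omega> = i \<and> jump_time n \<omega> \<in> C) \<and> S n \<omega> \<in> B} =
      emeasure (scale_measure (emeasure \<nu> C) \<kappa>) B"
    proof (rule emeasure_restricted_distr_eqI)
      fix s
      have "emeasure M {\<omega> \<in> space M. (Y n \<omega> = i \<and> jump_time n \<omega> \<in> C) \<and> s < S n \<omega>} =
        emeasure M {\<omega> \<in> space M. Y n \<omega> = i \<and> jump_time n \<omega> \<in> C \<and> max s 0 < S n \<omega>}"
        by (rule emeasure_Collect_eq_AE) (use AE_S_pos in \<open>auto elim: eventually_mono\<close>)
      also have "\<dots> = emeasure \<nu> C * emeasure \<kappa> {s<..}"
        unfolding \<kappa>_def exponential_tail[OF exit_rate_pos] \<nu>[OF C]
        by (simp only: emeasure_eq_measure prob_holding_tail[OF C max.cobounded2] ennreal_mult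
             exp_ge_zero measure_nonneg mult.commute)
      finally show "emeasure M {\<omega> \<in> space M. (Y n \<omega> = i \<and> jump_time n \<omega> \<in> C) \<and> s < S n \<omega>} =
        emeasure (scale_measure (emeasure \<nu> C) \<kappa>) {s<..}" by simp
    qed (auto simp: \<kappa>_def)
    then show "emeasure \<nu> C * emeasure \<kappa> B =
      emeasure (distr N (borel \<Otimes>\<^sub>M borel) (\<lambda>\<omega>. (jump_time n \<omega>, S n \<omega>))) (C \<times> B)"
      unfolding N_def by (subst emeasure_restricted_distr) (auto simp: conj_assoc)
  qed unfold_locales
qed

text \<open>Extended nonnegative values allow exchanging sums over \<open>n\<close> and time
  integrals without integrability conditions.\<close>

definition occ :: "nat \<Rightarrow> nat \<Rightarrow> real \<Rightarrow> ennreal" where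
  "occ n i t = emeasure M {\<omega> \<in> space M. Y n \<omega> = i \<and> jump_time n \<omega> \<le> t \<and> t < jump_time (Suc n) \<omega>}"

lemma occ_measurable[measurable]: "occ n i \<in> borel_measurable borel"
proof -
  have "occ n i t = (\<integral>\<^sup>+\<omega>. (if Y n \<omega> = i \<and> jump_time n \<omega> \<le> t \<and> t < jump_time (Suc n) \<omega> then 1 else 0) \<partial>M)" for t
  proof -
    have "(\<integral>\<^sup>+\<omega>. (if Y n \<omega> = i \<and> jump_time n \<omega> \<le> t \<and> t < jump_time (Suc n) \<omega> then 1 else 0) \<partial>M) =
      (\<integral>\<^sup>+\<omega>. indicator {\<omega> \<in> space M. Y n \<omega> = i \<and> jump_time n \<omega> \<le> t \<and> t < jump_time (Suc n) \<omega>} \<omega> \<partial>M)"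
      by (rule nn_integral_cong) (auto simp: indicator_def)
    then show ?thesis unfolding occ_def by simp
  qed
  then show ?thesis by (subst measurable_cong) measurable
qed

text \<open>Integrate the identity of \<open>nn_integral_exp_decay\<close> over the law of the
  arrival time and exchange the two integrals.\<close>

lemma emeasure_next_jump_le:
  "emeasure M {\<omega> \<in> space M. Y n \<omega> = i \<and> jump_time (Suc n) \<omega> \<le> t}
   = ennreal (exit_rate r i) * (\<integral>\<^sup>+s. indicator {0..t} s * occ n i s \<partial>lborel)"
proof -
  let ?q = "exit_rate r i"
  define N where "N = density M (indicator {\<omega> \<in> space M. Y n \<omega> = i})"
  define \<nu> where "\<nu> = distr N borel (jump_time n)"
  define \<kappa> where "\<kappa> = density lborel (exponential_density ?q)"
  have q: "0 < ?q" by (rule exit_rate_pos)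
  note law = joint_law_jump_hold(1,2)[where n = n and i = i, folded N_def, folded \<nu>_def \<kappa>_def]
     joint_law_jump_hold(3)[of i, folded \<kappa>_def]
  interpret \<nu>: finite_measure \<nu> by (rule law)
  interpret \<kappa>: prob_space \<kappa> by (rule law)
  interpret pair_sigma_finite lborel \<nu> by unfold_locales
  have [measurable_cong]: "sets \<nu> = sets borel" "sets \<kappa> = sets borel" by (auto simp: \<nu>_def \<kappa>_def)
  \<comment> \<open>The identity for a single visit requires an arrival time
    \<open>x \<ge> 0\<close>.\<close>
  have \<nu>nn: "AE x in \<nu>. 0 \<le> x"
  proof -
    have "emeasure \<nu> {..<0} = emeasure M {\<omega> \<in> space M. Y n \<omega> = i \<and> jump_time n \<omega> \<in> {..<0}}"
      unfolding \<nu>_def N_def by (subst emeasure_restricted_distr) auto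
    also have "\<dots> = emeasure M {\<omega> \<in> space M. False}"
      by (rule emeasure_Collect_eq_AE) (use AE_jump_time_nonneg in \<open>auto elim: eventually_mono simp: not_less\<close>)
    finally have "emeasure \<nu> {..<0} = 0" by simp
    then show ?thesis by (subst AE_iff_measurable[of "{..<0}"]) (auto simp: \<nu>_def)
  qed
  have joint: "emeasure M {\<omega> \<in> space M. Y n \<omega> = i \<and> (jump_time n \<omega>, S n \<omega>) \<in> D}
      = (\<integral>\<^sup>+x. emeasure \<kappa> (Pair x -` D) \<partial>\<nu>)"
    if D: "D \<in> sets (borel \<Otimes>\<^sub>M borel)" for D
  proof -
    have "emeasure M {\<omega> \<in> space M. Y n \<omega> = i \<and> (jump_time n \<omega>, S n \<omega>) \<in> D} = emeasure (\<nu> \<Otimes>\<^sub>M \<kappa>) D"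
      unfolding law(1) N_def using D by (subst emeasure_restricted_distr) auto
    also have "\<dots> = (\<integral>\<^sup>+x. emeasure \<kappa> (Pair x -` D) \<partial>\<nu>)"
      using D by (intro \<kappa>.emeasure_pair_measure_alt) (simp cong: sets_pair_measure_cong add: \<nu>_def \<kappa>_def)
    finally show ?thesis .
  qed
  have occ: "occ n i s = (\<integral>\<^sup>+x. indicator {x..} s * ennreal (exp (- ?q * (s - x))) \<partial>\<nu>)" for s
  proof -
    have "occ n i s = emeasure M {\<omega> \<in> space M. Y n \<omega> = i \<and> (jump_time n \<omega>, S n \<omega>) \<in> {p. fst p \<le> s \<and> s < fst p + snd p}}"
      unfolding occ_def by (simp add: jump_time_Suc)
    also have "\<dots> = (\<integral>\<^sup>+x. emeasure \<kappa> (Pair x -` {p. fst p \<le> s \<and> s < fst p + snd p}) \<partial>\<nu>)"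
      \<comment> \<open>The region is the preimage of a rectangle under (arrival, holding) \<mapsto>
        (arrival, departure).\<close>
      using measurable_sets[of "\<lambda>p. (fst p, fst p + snd p)" "borel \<Otimes>\<^sub>M borel" "borel \<Otimes>\<^sub>M borel" "{..s} \<times> {s<..}"]
      by (intro joint) (simp add: vimage_def space_pair_measure)
    also have "\<dots> = (\<integral>\<^sup>+x. indicator {x..} s * ennreal (exp (- ?q * (s - x))) \<partial>\<nu>)"
    proof (rule nn_integral_cong)
      fix x
      have "Pair x -` {p. fst p \<le> s \<and> s < fst p + snd p} = (if x \<le> s then {s - x<..} else {})" by auto
      then show "emeasure \<kappa> (Pair x -` {p. fst p \<le> s \<and> s < fst p + snd p}) =
        indicator {x..} s * ennreal (exp (- ?q * (s - x)))"
        unfolding \<kappa>_def by (auto simp: exponential_tail[OF q] max_def)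
    qed
    finally show ?thesis .
  qed
  have "emeasure M {\<omega> \<in> space M. Y n \<omega> = i \<and> jump_time (Suc n) \<omega> \<le> t} =
    emeasure M {\<omega> \<in> space M. Y n \<omega> = i \<and> (jump_time n \<omega>, S n \<omega>) \<in> {p. fst p + snd p \<le> t}}"
    by (simp add: jump_time_Suc)
  also have "\<dots> = (\<integral>\<^sup>+x. emeasure \<kappa> (Pair x -` {p. fst p + snd p \<le> t}) \<partial>\<nu>)"
    using measurable_sets[of "\<lambda>p. fst p + snd p" "borel \<Otimes>\<^sub>M borel" borel "{..t}"]
    by (intro joint) (simp add: vimage_def space_pair_measure)
  also have "\<dots> = (\<integral>\<^sup>+x. indicator {..t} x * ennreal (1 - exp (- ?q * (t - x))) \<partial>\<nu>)"
  proof (rule nn_integral_cong)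
    fix x
    have "Pair x -` {p. fst p + snd p \<le> t} = {..t - x}" by auto
    then show "emeasure \<kappa> (Pair x -` {p. fst p + snd p \<le> t}) = indicator {..t} x * ennreal (1 - exp (- ?q * (t - x)))"
      unfolding \<kappa>_def by (auto simp: exponential_tail[OF q] max_def indicator_def)
  qed
  also have "\<dots> = (\<integral>\<^sup>+x. ennreal ?q *
      (\<integral>\<^sup>+s. indicator {0..t} s * (indicator {x..} s * ennreal (exp (- ?q * (s - x)))) \<partial>lborel) \<partial>\<nu>)"
    by (rule nn_integral_cong_AE)
       (use \<nu>nn in \<open>eventually_elim, simp only: nn_integral_exp_decay[OF q]\<close>)
  also have "\<dots> = ennreal ?q *
      (\<integral>\<^sup>+x. (\<integral>\<^sup>+s. indicator {0..t} s * (indicator {x..} s * ennreal (exp (- ?q * (s - x)))) \<partial>lborel) \<partial>\<nu>)"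
    unfolding atLeast_def by (rule nn_integral_cmult) measurable
  also have "(\<integral>\<^sup>+x. (\<integral>\<^sup>+s. indicator {0..t} s * (indicator {x..} s * ennreal (exp (- ?q * (s - x)))) \<partial>lborel) \<partial>\<nu>) =
     (\<integral>\<^sup>+s. (\<integral>\<^sup>+x. indicator {0..t} s * (indicator {x..} s * ennreal (exp (- ?q * (s - x)))) \<partial>\<nu>) \<partial>lborel)"
    unfolding atLeast_def by (rule Fubini') measurable
  also have "\<dots> = (\<integral>\<^sup>+s. indicator {0..t} s * occ n i s \<partial>lborel)"
    unfolding occ atLeast_def by (intro nn_integral_cong nn_integral_cmult) measurable
  finally show ?thesis .
qed

definition jumped :: "nat \<Rightarrow> nat \<Rightarrow> real \<Rightarrow> ennreal" where
  "jumped n i t = emeasure M {\<omega> \<in> space M. Y n \<omega> = i \<and> jump_time n \<omega> \<le> t}"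

text \<open>Having arrived by time \<open>t\<close>, the walk either is still on that visit or has
  already left.\<close>

lemma occ_balance:
  "occ n i t + ennreal (exit_rate r i) * (\<integral>\<^sup>+s. indicator {0..t} s * occ n i s \<partial>lborel) = jumped n i t"
proof -
  let ?A = "{\<omega> \<in> space M. Y n \<omega> = i \<and> jump_time n \<omega> \<le> t \<and> t < jump_time (Suc n) \<omega>}"
  let ?B = "{\<omega> \<in> space M. Y n \<omega> = i \<and> jump_time (Suc n) \<omega> \<le> t}"
  have "emeasure M ?A + emeasure M ?B = emeasure M (?A \<union> ?B)"
    by (rule plus_emeasure) auto
  also have "\<dots> = jumped n i t"
    unfolding jumped_def
  proof (rule emeasure_eq_AE)
    show "AE \<omega> in M. (\<omega> \<in> ?A \<union> ?B) = (\<omega> \<in> {\<omega> \<in> space M. Y n \<omega> = i \<and> jump_time n \<omega> \<le> t})"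
      using AE_S_pos
    proof eventually_elim
      case (elim \<omega>)
      then have "jump_time n \<omega> < jump_time (Suc n) \<omega>" by (simp add: jump_time_Suc)
      then show ?case by auto
    qed
  qed auto
  finally show ?thesis unfolding emeasure_next_jump_le occ_def .
qed

lemma jumped_0: "0 \<le> t \<Longrightarrow> jumped 0 i t = (if i = 0 then 1 else 0)"
proof -
  assume t: "0 \<le> t"
  have "jumped 0 i t = emeasure M {\<omega> \<in> space M. i = 0}"
    unfolding jumped_def
    by (rule emeasure_Collect_eq_AE) (use AE_Y_0 t in \<open>auto elim: eventually_mono\<close>)
  then show ?thesis by (simp add: emeasure_space_1)
qed

text \<open>Split the arrival by the previous state, which is almost surely at most
  \<open>Suc j\<close>. The exit rate in the departure probability cancels against the denominator
  of the transition probability.\<close>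

lemma jumped_Suc:
  "jumped (Suc n) j t = (\<Sum>i\<le>Suc j. ennreal (jump_rate r i j) * (\<integral>\<^sup>+s. indicator {0..t} s * occ n i s \<partial>lborel))"
proof -
  let ?A = "\<lambda>i. {\<omega> \<in> space M. Y n \<omega> = i \<and> Y (Suc n) \<omega> = j \<and> jump_time (Suc n) \<omega> \<in> {..t}}"
  have "jumped (Suc n) j t = emeasure M (\<Union>i\<le>Suc j. ?A i)"
    unfolding jumped_def
  proof (rule emeasure_eq_AE)
    show "AE \<omega> in M. (\<omega> \<in> {\<omega> \<in> space M. Y (Suc n) \<omega> = j \<and> jump_time (Suc n) \<omega> \<le> t}) = (\<omega> \<in> (\<Union>i\<le>Suc j. ?A i))"
      using AE_jump
    proof eventually_elim
      case (elim \<omega>)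
      then have "jump_rate r (Y n \<omega>) (Y (Suc n) \<omega>) \<noteq> 0" by blast
      then have "Y n \<omega> \<le> Suc (Y (Suc n) \<omega>)" by (auto simp: jump_rate_def split: if_splits)
      then show ?case by auto
    qed
  qed auto
  also have "\<dots> = (\<Sum>i\<le>Suc j. emeasure M (?A i))"
    by (rule sum_emeasure[symmetric]) (auto simp: disjoint_family_on_def)
  also have "\<dots> = (\<Sum>i\<le>Suc j. ennreal (jump_rate r i j) * (\<integral>\<^sup>+s. indicator {0..t} s * occ n i s \<partial>lborel))"
  proof (rule sum.cong)
    fix i
    have q: "0 < exit_rate r i" by (rule exit_rate_pos)
    have "emeasure M (?A i) = ennreal (jump_rate r i j / exit_rate r i) *
        emeasure M {\<omega> \<in> space M. Y n \<omega> = i \<and> jump_time (Suc n) \<omega> \<in> {..t}}"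
      using q jump_rate_nonneg[of i j]
      by (simp only: emeasure_eq_measure prob_jump[OF atMost_borel] ennreal_mult[symmetric]
          zero_le_divide_iff measure_nonneg less_imp_le simp_thms)
    also have "emeasure M {\<omega> \<in> space M. Y n \<omega> = i \<and> jump_time (Suc n) \<omega> \<in> {..t}} =
      ennreal (exit_rate r i) * (\<integral>\<^sup>+s. indicator {0..t} s * occ n i s \<partial>lborel)"
      by (simp add: emeasure_next_jump_le)
    also have "ennreal (jump_rate r i j / exit_rate r i) *
        (ennreal (exit_rate r i) * (\<integral>\<^sup>+s. indicator {0..t} s * occ n i s \<partial>lborel))
      = ennreal (jump_rate r i j) * (\<integral>\<^sup>+s. indicator {0..t} s * occ n i s \<partial>lborel)"
      using q jump_rate_nonneg[of i j] by (simp add: mult.assoc[symmetric] ennreal_mult[symmetric])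
    finally show "emeasure M (?A i) = ennreal (jump_rate r i j) * (\<integral>\<^sup>+s. indicator {0..t} s * occ n i s \<partial>lborel)" .
  qed simp
  finally show ?thesis .
qed

text \<open>Sum the balance over \<open>n\<close>; the arrivals with index 0 give the initial
  condition. Losses and gains stay on opposite sides to avoid subtraction in
  \<open>ennreal\<close>.\<close>

lemma occ_sum_forward:
  assumes t: "0 \<le> t"
  shows "(\<Sum>n. occ n j t) + ennreal (exit_rate r j) * (\<integral>\<^sup>+s. indicator {0..t} s * (\<Sum>n. occ n j s) \<partial>lborel) =
    (if j = 0 then 1 else 0) + (\<Sum>i\<le>Suc j. ennreal (jump_rate r i j) *
        (\<integral>\<^sup>+s. indicator {0..t} s * (\<Sum>n. occ n i s) \<partial>lborel))"
proof -
  have int: "(\<integral>\<^sup>+s. indicator {0..t} s * (\<Sum>n. occ n i s) \<partial>lborel) =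
      (\<Sum>n. \<integral>\<^sup>+s. indicator {0..t} s * occ n i s \<partial>lborel)" for i
    unfolding ennreal_suminf_cmult[symmetric] by (rule nn_integral_suminf) measurable
  have "(\<Sum>n. occ n j t) + ennreal (exit_rate r j) * (\<integral>\<^sup>+s. indicator {0..t} s * (\<Sum>n. occ n j s) \<partial>lborel) =
      (\<Sum>n. jumped n j t)"
    unfolding occ_balance[symmetric] suminf_add[OF summableI summableI, symmetric] ennreal_suminf_cmult int ..
  also have "\<dots> = jumped 0 j t + (\<Sum>n. jumped (Suc n) j t)"
    using suminf_offset[OF summableI, of "\<lambda>n. jumped n j t" 1] by simp
  also have "(\<Sum>n. jumped (Suc n) j t) = (\<Sum>i\<le>Suc j. ennreal (jump_rate r i j) *
        (\<integral>\<^sup>+s. indicator {0..t} s * (\<Sum>n. occ n i s) \<partial>lborel))"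
    unfolding jumped_Suc int suminf_sum[OF summableI] ennreal_suminf_cmult ..
  finally show ?thesis using t by (simp add: jumped_0)
qed

end

lemma sum_jump_rate:
  fixes f :: "nat \<Rightarrow> real"
  shows "(\<Sum>i\<le>Suc j. jump_rate r i j * f i) = r (Suc j) * f (Suc j) + (if j = 0 then 0 else r j * f (j - 1))"
proof (cases j)
  case 0
  then show ?thesis by (simp add: jump_rate_def)
next
  case (Suc k)
  have "(\<Sum>i<k. jump_rate r i (Suc k) * f i) = 0"
    by (intro sum.neutral) (auto simp: jump_rate_def)
  then show ?thesis using Suc
    by (simp add: lessThan_Suc_atMost[symmetric] jump_rate_def)
qed

lemma exit_rate_eq: "exit_rate r j = r (Suc j) + (if j = 0 then 0 else r j)"
proof -
  have "jump_rate r i j = jump_rate r j i" for i by (auto simp: jump_rate_def)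
  then show ?thesis using sum_jump_rate[of r j "\<lambda>_. 1"] by (simp add: exit_rate_def)
qed

text \<open>Consecutive states differ, so every \<open>\<tau> (Suc n)\<close> is a genuine jump of
  the path. Bounded jump times would therefore contradict non-explosion.\<close>

lemma jump_times_infinite:
  fixes Z :: "real \<Rightarrow> 'w \<Rightarrow> nat"
  assumes \<tau>: "\<And>n. \<tau> n < \<tau> (Suc n)" "\<tau> 0 = (0::real)"
    and Z: "\<And>n t. \<tau> n \<le> t \<Longrightarrow> t < \<tau> (Suc n) \<Longrightarrow> Z t \<omega> = y n"
    and y: "\<And>n. y n \<noteq> y (Suc n)" and B: "\<And>n. \<tau> n \<le> B"
  shows "infinite (jump_times Z \<omega> \<inter> {..B})"
proof -
  have mono: "strict_mono \<tau>" by (rule strict_mono_Suc_iff[THEN iffD2]) (use \<tau> in blast)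
  have "\<tau> (Suc n) \<in> jump_times Z \<omega>" for n
  proof -
    have "0 < \<tau> (Suc n)" using strict_monoD[OF mono, of 0 "Suc n"] \<tau>(2) by simp
    moreover have "\<not> (\<forall>\<^sub>F u in at_left (\<tau> (Suc n)). Z u \<omega> = Z (\<tau> (Suc n)) \<omega>)"
    proof
      assume *: "\<forall>\<^sub>F u in at_left (\<tau> (Suc n)). Z u \<omega> = Z (\<tau> (Suc n)) \<omega>"
      have "\<forall>\<^sub>F u in at_left (\<tau> (Suc n)). u \<in> {\<tau> n<..<\<tau> (Suc n)}"
        by (rule eventually_at_left_real[OF \<tau>(1)])
      with * have "\<forall>\<^sub>F u in at_left (\<tau> (Suc n)). False"
      proof eventually_elim
        case (elim u)
        then have "Z u \<omega> = y n" by (intro Z) auto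
        moreover have "Z (\<tau> (Suc n)) \<omega> = y (Suc n)" using \<tau>(1) by (intro Z) auto
        ultimately show False using elim(1) y[of n] by simp
      qed
      then show False by simp
    qed
    ultimately show ?thesis unfolding jump_times_def by blast
  qed
  then have "range (\<lambda>n. \<tau> (Suc n)) \<subseteq> jump_times Z \<omega> \<inter> {..B}" using B by auto
  moreover have "infinite (range (\<lambda>n. \<tau> (Suc n)))"
    by (rule range_inj_infinite) (auto intro!: injI simp: strict_mono_eq[OF mono])
  ultimately show ?thesis using finite_subset by blast
qed

section \<open>The law of the non-explosive process\<close>

locale walk_process = walk M r Y S for M :: "'w measure" and r Y S +
  fixes Z :: "real \<Rightarrow> 'w \<Rightarrow> nat"
  assumes Z_measurable: "\<And>t. 0 \<le> t \<Longrightarrow> Z t \<in> M \<rightarrow>\<^sub>M count_space UNIV"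
    and Z_eq: "AE \<omega> in M. \<forall>n t. jump_time n \<omega> \<le> t \<and> t < jump_time (Suc n) \<omega> \<longrightarrow> Z t \<omega> = Y n \<omega>"
    and Z_non_explosive: "non_explosive M Z"
begin

lemma jump_time_mono: "(\<And>k. 0 < S k \<omega>) \<Longrightarrow> m \<le> n \<Longrightarrow> jump_time m \<omega> \<le> jump_time n \<omega>"
  unfolding jump_time_def by (intro sum_mono2) (auto intro: less_imp_le)

lemma AE_covered: "AE \<omega> in M. \<forall>t\<ge>0. \<exists>n. jump_time n \<omega> \<le> t \<and> t < jump_time (Suc n) \<omega>"
  using AE_S_pos AE_jump Z_eq Z_non_explosive[unfolded non_explosive_def]
proof eventually_elim
  case (elim \<omega>)
  have Y: "Y n \<omega> \<noteq> Y (Suc n) \<omega>" for n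
  proof
    assume "Y n \<omega> = Y (Suc n) \<omega>"
    with elim(2) have "jump_rate r (Y n \<omega>) (Y n \<omega>) \<noteq> 0" by metis
    then show False by (simp add: jump_rate_def)
  qed
  show ?case
  proof (intro allI impI)
    fix t :: real assume t: "0 \<le> t"
    have "\<exists>n. t < jump_time n \<omega>"
    proof (rule ccontr)
      assume "\<nexists>n. t < jump_time n \<omega>"
      then have "infinite (jump_times Z \<omega> \<inter> {..t})"
        using elim Y by (intro jump_times_infinite[where \<tau> = "\<lambda>n. jump_time n \<omega>" and y = "\<lambda>n. Y n \<omega>"])
          (auto simp: jump_time_Suc not_less)
      with elim show False by blast
    qed
    \<comment> \<open>The least index is positive because
      \<open>jump_time 0 \<omega> = 0 \<le> t\<close>; its predecessor is the wanted one.\<close>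
    define n where "n = (LEAST n. t < jump_time n \<omega>)"
    have n: "t < jump_time n \<omega>" unfolding n_def by (rule LeastI_ex) fact
    then obtain k where k: "n = Suc k" using t by (cases n) auto
    then have "\<not> t < jump_time k \<omega>" using not_less_Least[of k "\<lambda>n. t < jump_time n \<omega>"] unfolding n_def by simp
    with n k show "\<exists>n. jump_time n \<omega> \<le> t \<and> t < jump_time (Suc n) \<omega>" by (intro exI[of _ k]) auto
  qed
qed

definition mass :: "nat \<Rightarrow> real \<Rightarrow> real" where
  "mass i t = prob {\<omega> \<in> space M. Z t \<omega> = i}"

text \<open>Almost surely the holding intervals partition the nonnegative times, and
  \<open>Z\<close> agrees with the jump chain on each of them.\<close>

lemma suminf_occ:
  assumes t: "0 \<le> t"
  shows "(\<Sum>n. occ n i t) = ennreal (mass i t)"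
proof -
  note [measurable] = Z_measurable[OF t]
  \<comment> \<open>Positivity of all holding times is built in so that the events are disjoint
    everywhere and not just almost surely.\<close>
  define A where "A n = {\<omega> \<in> space M. Y n \<omega> = i \<and> jump_time n \<omega> \<le> t \<and> t < jump_time (Suc n) \<omega> \<and> (\<forall>k. 0 < S k \<omega>)}" for n
  have A[measurable]: "A n \<in> sets M" for n unfolding A_def by measurable
  have "occ n i t = emeasure M (A n)" for n
    unfolding occ_def A_def by (rule emeasure_Collect_eq_AE) (use AE_S_pos in auto)
  moreover have "disjoint_family A"
  proof -
    have "A m \<inter> A n = {}" if "m < n" for m n
    proof -
      have False if \<omega>: "\<omega> \<in> A m" "\<omega> \<in> A n" for \<omega>
        using jump_time_mono[of \<omega> "Suc m" n] \<open>m < n\<close> \<omega> unfolding A_def by auto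
      then show ?thesis by blast
    qed
    then show ?thesis unfolding disjoint_family_on_def by (metis Int_commute linorder_neqE_nat)
  qed
  ultimately have "(\<Sum>n. occ n i t) = emeasure M (\<Union>n. A n)"
    by (simp add: suminf_emeasure image_subset_iff)
  also have "\<dots> = emeasure M {\<omega> \<in> space M. Z t \<omega> = i}"
  proof (rule emeasure_eq_AE)
    show "AE \<omega> in M. (\<omega> \<in> (\<Union>n. A n)) = (\<omega> \<in> {\<omega> \<in> space M. Z t \<omega> = i})"
      using AE_S_pos AE_covered Z_eq
    proof eventually_elim
      case (elim \<omega>)
      from elim(2) t obtain n where n: "jump_time n \<omega> \<le> t" "t < jump_time (Suc n) \<omega>" by blast
      have "Z t \<omega> = Y m \<omega>" if "jump_time m \<omega> \<le> t" "t < jump_time (Suc m) \<omega>" for m using elim(3) that by blast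
      then have "Z t \<omega> = i \<longleftrightarrow> (\<exists>m. Y m \<omega> = i \<and> jump_time m \<omega> \<le> t \<and> t < jump_time (Suc m) \<omega>)" using n by metis
      with elim(1) show ?case unfolding A_def by blast
    qed
  qed auto
  finally show ?thesis by (simp add: mass_def emeasure_eq_measure)
qed

text \<open>Measurability of \<open>mass i\<close> in time comes from the series of
  \<open>occ\<close>, since \<open>Z\<close> is only assumed measurable at each fixed time.
  Finiteness comes from the bound 1.\<close>

lemma mass_has_integral:
  assumes t: "0 \<le> t"
  shows "mass i integrable_on {0..t}"
    and "(\<integral>\<^sup>+s. indicator {0..t} s * (\<Sum>n. occ n i s) \<partial>lborel) = ennreal (integral {0..t} (mass i))"
proof -
  let ?J = "\<integral>\<^sup>+s. indicator {0..t} s * (\<Sum>n. occ n i s) \<partial>lborel"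
  define f where "f s = indicator {0..t} s * mass i s" for s
  have f: "f s = indicator {0..t} s * enn2real (\<Sum>n. occ n i s)" for s
    unfolding f_def by (auto simp: indicator_def suminf_occ mass_def)
  have f_meas: "f \<in> borel_measurable borel"
    by (subst measurable_cong[OF f]) measurable
  have J: "(\<integral>\<^sup>+s. ennreal (f s) \<partial>lborel) = ?J"
    by (rule nn_integral_cong) (auto simp: f_def indicator_def suminf_occ)
  have "?J \<le> (\<integral>\<^sup>+s. indicator {0..t} s \<partial>lborel)"
    by (rule nn_integral_mono) (auto simp: indicator_def suminf_occ mass_def)
  also have "\<dots> = ennreal t" using t by simp
  finally have fin: "?J < \<infinity>" by (simp add: le_less_trans)
  then have J': "(\<integral>\<^sup>+s. ennreal (f s) \<partial>lborel) = ennreal (enn2real ?J)" unfolding J by simp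
  have "(f has_integral enn2real ?J) UNIV"
    by (rule nn_integral_has_integral[OF f_meas _ J']) (auto simp: f_def mass_def)
  moreover have "f = (\<lambda>s. if s \<in> {0..t} then mass i s else 0)"
    by (auto simp: f_def indicator_def)
  ultimately have *: "(mass i has_integral enn2real ?J) {0..t}"
    by (simp only: has_integral_restrict_UNIV)
  then show "mass i integrable_on {0..t}" by blast
  show "?J = ennreal (integral {0..t} (mass i))" using integral_unique[OF *] fin by simp
qed

lemma forward_equation:
  assumes t: "0 \<le> t"
  shows "mass j t + exit_rate r j * integral {0..t} (mass j) =
    (if j = 0 then 1 else 0) + (\<Sum>i\<le>Suc j. jump_rate r i j * integral {0..t} (mass i))"
proof -
  have I: "0 \<le> integral {0..t} (mass i)" for i
    by (rule integral_nonneg[OF mass_has_integral(1)[OF t]]) (simp add: mass_def)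
  have "ennreal (mass j t + exit_rate r j * integral {0..t} (mass j)) =
    ennreal ((if j = 0 then 1 else 0) + (\<Sum>i\<le>Suc j. jump_rate r i j * integral {0..t} (mass i)))"
    using occ_sum_forward[OF t, of j] I exit_rate_pos[of j] jump_rate_nonneg
    unfolding mass_has_integral(2)[OF t] suminf_occ[OF t]
    by (simp add: ennreal_plus ennreal_mult sum_nonneg sum_ennreal[symmetric]
        mass_def less_imp_le del: sum_ennreal sum.atMost_Suc)
  moreover have "0 \<le> mass j t + exit_rate r j * integral {0..t} (mass j)"
    using I exit_rate_pos[of j] by (simp add: mass_def less_imp_le)
  moreover have "0 \<le> (if j = 0 then 1 else 0) + (\<Sum>i\<le>Suc j. jump_rate r i j * integral {0..t} (mass i))"
    by (intro add_nonneg_nonneg sum_nonneg mult_nonneg_nonneg jump_rate_nonneg I) auto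
  ultimately show ?thesis by simp
qed

section \<open>The tail probabilities as a solution of the tail equation\<close>

definition tail :: "nat \<Rightarrow> real \<Rightarrow> real" where
  "tail i t = prob {\<omega> \<in> space M. i \<le> Z t \<omega>}"

lemma mass_eq_diff: "0 \<le> t \<Longrightarrow> mass i t = tail i t - tail (Suc i) t"
proof -
  assume t: "0 \<le> t"
  note [measurable] = Z_measurable[OF t]
  have "tail i t = prob ({\<omega> \<in> space M. Z t \<omega> = i} \<union> {\<omega> \<in> space M. Suc i \<le> Z t \<omega>})"
    unfolding tail_def by (rule arg_cong[where f = prob]) auto
  also have "\<dots> = mass i t + tail (Suc i) t"
    unfolding mass_def tail_def by (rule finite_measure_Union) auto
  finally show ?thesis by simp
qed

lemma tail_bounds: "0 \<le> tail i t" "tail i t \<le> 1"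
  by (simp_all add: tail_def)

lemma tail_0: "tail 0 t = 1"
  using prob_space by (simp add: tail_def)

text \<open>Mass leaves \<open>{..i}\<close> only through the edge between \<open>i\<close> and \<open>Suc i\<close>.\<close>
lemma tail_Suc:
  assumes t: "0 \<le> t"
  shows "tail (Suc i) t = r (Suc i) * (integral {0..t} (mass i) - integral {0..t} (mass (Suc i)))"
proof (induction i)
  case 0
  have "mass 0 t + r 1 * integral {0..t} (mass 0) = 1 + r 1 * integral {0..t} (mass 1)"
    using forward_equation[OF t, of 0] unfolding sum_jump_rate exit_rate_eq by simp
  then show ?case using mass_eq_diff[OF t, of 0] by (simp add: tail_0 algebra_simps)
next
  case (Suc i)
  \<comment> \<open>The net flow through the edge between \<open>i\<close> and \<open>Suc i\<close>
    also occurs in the induction hypothesis and cancels, leaving that of the next edge.\<close>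
  have "mass (Suc i) t + (r (Suc (Suc i)) + r (Suc i)) * integral {0..t} (mass (Suc i)) =
     r (Suc (Suc i)) * integral {0..t} (mass (Suc (Suc i))) + r (Suc i) * integral {0..t} (mass i)"
    using forward_equation[OF t, of "Suc i"] unfolding sum_jump_rate exit_rate_eq by simp
  then show ?case using mass_eq_diff[OF t, of "Suc i"] Suc by (simp add: algebra_simps)
qed

lemma continuous_on_integral_mass: "continuous_on {0..} (\<lambda>t. integral {0..t} (mass i))"
  unfolding continuous_on_eq_continuous_within
proof
  fix x :: real assume x: "x \<in> {0..}"
  have "continuous_on {0..x + 1} (\<lambda>t. integral {0..t} (mass i))"
    using x by (intro indefinite_integral_continuous_1 mass_has_integral) auto
  then have "continuous (at x within {0..x + 1}) (\<lambda>t. integral {0..t} (mass i))"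
    using x by (auto simp: continuous_on_eq_continuous_within)
  moreover have "at x within {0..x + 1} = at x within {0..}"
    by (rule at_within_nhd[of _ "{..<x + 1}"]) auto
  ultimately show "continuous (at x within {0..}) (\<lambda>t. integral {0..t} (mass i))" by simp
qed

lemma continuous_on_tail: "continuous_on {0..} (tail i)"
proof (cases i)
  case 0
  then show ?thesis by (simp add: tail_0[abs_def])
next
  case (Suc k)
  have "continuous_on {0..} (\<lambda>t. r (Suc k) * (integral {0..t} (mass k) - integral {0..t} (mass (Suc k))))"
    by (intro continuous_intros continuous_on_integral_mass)
  then show ?thesis by (rule continuous_on_eq) (simp add: tail_Suc Suc)
qed

text \<open>A bootstrap: the integrals are continuous in time, hence so are the tails by
  \<open>tail_Suc\<close>, hence so is \<open>mass i\<close>, and the fundamental theorem of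
  calculus applies.\<close>

lemma deriv_integral_mass:
  assumes t: "0 < t"
  shows "((\<lambda>t. integral {0..t} (mass i)) has_real_derivative mass i t) (at t)"
proof -
  have "continuous_on {0..} (\<lambda>t. tail i t - tail (Suc i) t)"
    by (intro continuous_on_diff continuous_on_tail)
  then have "continuous_on {0..} (mass i)" by (rule continuous_on_eq) (simp add: mass_eq_diff)
  then have "continuous_on {0..t + 1} (mass i)" by (rule continuous_on_subset) auto
  then have "((\<lambda>t. integral {0..t} (mass i)) has_real_derivative mass i t) (at t within {0..t + 1})"
    by (rule integral_has_real_derivative) (use t in auto)
  moreover have "at t within {0..t + 1} = at t"
    by (rule at_within_interior) (use t in \<open>simp add: interior_atLeastAtMost_real\<close>)
  ultimately show ?thesis by simp
qed

lemma tail_solution_tail: "tail_solution r tail"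
  unfolding tail_solution_def
proof (intro conjI allI impI)
  fix i :: nat and t :: real assume i: "1 \<le> i" and t: "0 < t"
  then obtain k where k: "i = Suc k" by (cases i) auto
  have "((\<lambda>t. r (Suc k) * (integral {0..t} (mass k) - integral {0..t} (mass (Suc k))))
      has_real_derivative r (Suc k) * (mass k t - mass (Suc k) t)) (at t)"
    by (intro DERIV_cmult DERIV_diff deriv_integral_mass t)
  \<comment> \<open>\<open>tail_Suc\<close> holds for nonnegative times only, so the derivative is
    transferred along a neighbourhood of positive times.\<close>
  moreover have "\<forall>\<^sub>F u in nhds t. u \<in> {0<..}" using t by (intro eventually_nhds_in_open) auto
  then have "\<forall>\<^sub>F u in nhds t. tail (Suc k) u =
      r (Suc k) * (integral {0..u} (mass k) - integral {0..u} (mass (Suc k)))"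
    by eventually_elim (simp add: tail_Suc)
  ultimately have "(tail (Suc k) has_real_derivative r (Suc k) * (mass k t - mass (Suc k) t)) (at t)"
    by (subst DERIV_cong_ev[OF refl _ refl])
  then show "(tail i has_real_derivative r i * (tail (i - 1) t - 2 * tail i t + tail (Suc i) t)) (at t)"
    using t by (simp add: k mass_eq_diff algebra_simps)
next
  fix i :: nat assume "1 \<le> i"
  then show "tail i 0 = 0" using tail_Suc[of 0 "i - 1"] by simp
qed (simp_all add: tail_0 continuous_on_tail tail_bounds)

lemma expectation_eq_suminf_tail:
  assumes t: "0 \<le> t"
  shows "(\<integral>\<^sup>+ \<omega>. of_nat (Z t \<omega>) \<partial>M) = (\<Sum>i. ennreal (tail (Suc i) t))"
  using nn_integral_nat_function[OF Z_measurable[OF t]] by (simp add: tail_def emeasure_eq_measure Suc_le_eq)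

end

text \<open>Hides the probability space, jump chain and holding times behind a deterministic family
  \<open>F\<close>, so that walks on different spaces can be compared without a coupling.\<close>

lemma random_walk_tail_solution:
  fixes M :: "'w measure" and Z :: "real \<Rightarrow> 'w \<Rightarrow> nat"
  assumes r: "\<And>i. 1 \<le> i \<Longrightarrow> 0 < r i" and Z: "random_walk M r Z" "non_explosive M Z"
  obtains F where "tail_solution r F"
    "\<And>t. 0 \<le> t \<Longrightarrow> (\<integral>\<^sup>+ \<omega>. of_nat (Z t \<omega>) \<partial>M) = (\<Sum>i. ennreal (F (Suc i) t))"
proof -
  from Z(1) obtain Y :: "nat \<Rightarrow> 'w \<Rightarrow> nat" and S :: "nat \<Rightarrow> 'w \<Rightarrow> real"
    where "prob_space M" and chain: "jump_hold_chain M r Y S"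
    and meas: "\<And>t. 0 \<le> t \<Longrightarrow> Z t \<in> M \<rightarrow>\<^sub>M count_space UNIV"
    and eq: "AE \<omega> in M. \<forall>n t. (\<Sum>k<n. S k \<omega>) \<le> t \<and> t < (\<Sum>k<Suc n. S k \<omega>) \<longrightarrow> Z t \<omega> = Y n \<omega>"
    unfolding random_walk_def by blast
  interpret prob_space M by fact
  interpret W: walk M r Y S by unfold_locales (use r chain in auto)
  interpret W: walk_process M r Y S Z
    by unfold_locales (use meas eq Z(2) in \<open>auto simp: W.jump_time_def\<close>)
  from W.tail_solution_tail W.expectation_eq_suminf_tail show ?thesis by (rule that)
qed

theorem theorem1p3:
  fixes r r' :: "nat \<Rightarrow> real"
    and M :: "'w measure" and M' :: "'v measure"
    and Z :: "real \<Rightarrow> 'w \<Rightarrow> nat" and Z' :: "real \<Rightarrow> 'v \<Rightarrow> nat"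
    and t :: real
  assumes "\<And>i. 1 \<le> i \<Longrightarrow> 0 < r i"
    and "\<And>i. 1 \<le> i \<Longrightarrow> 0 < r' i"
    and "\<And>i. 1 \<le> i \<Longrightarrow> r i \<le> r' i"
    and "random_walk M r Z" and "non_explosive M Z"
    and "random_walk M' r' Z'" and "non_explosive M' Z'"
    and "0 < t"
  shows "(\<integral>\<^sup>+ \<omega>. of_nat (Z t \<omega>) \<partial>M) \<le> (\<integral>\<^sup>+ \<omega>. of_nat (Z' t \<omega>) \<partial>M')"
proof -
  from random_walk_tail_solution[OF assms(1,4,5)] obtain F where F: "tail_solution r F"
    "\<And>t. 0 \<le> t \<Longrightarrow> (\<integral>\<^sup>+ \<omega>. of_nat (Z t \<omega>) \<partial>M) = (\<Sum>i. ennreal (F (Suc i) t))" by blast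
  from random_walk_tail_solution[OF assms(2,6,7)] obtain F' where F': "tail_solution r' F'"
    "\<And>t. 0 \<le> t \<Longrightarrow> (\<integral>\<^sup>+ \<omega>. of_nat (Z' t \<omega>) \<partial>M') = (\<Sum>i. ennreal (F' (Suc i) t))" by blast
  have "F i t \<le> F' i t" for i
    using tail_solution_mono_rate[OF assms(1,2,3) F(1) F'(1)] assms(8) by simp
  then show ?thesis using assms(8) by (simp add: F(2) F'(2) suminf_le ennreal_leI)
qed

end
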